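(* Let $R:\mathbb{T}\to\mathbb{C}$ be Riemann's non-differentiable function, $R(x)=\sum_{n=1}^{\infty}\frac{e^{2\pi i n^2 x}}{n^2}$. There exist $N_0\in\mathbb{N}$ and $0<\ell_0<1$ such that for all integers $N>N_0$ and all real $\ell$ with $0<\ell<\ell_0$, $$\lVert R_{\geq N}\rVert_{L^4(\mathbb{T})}^4\simeq N^{-3}\log N,\qquad \lVert R_{\geq N}\rVert_{L^2(\mathbb{T})}^2\simeq N^{-3/2},$$ and $$S_{R,4}(\ell)\simeq \ell^3\log(\ell^{-1}),\qquad S_{R,2}(\ell)\simeq \ell^{3/2}.$$ Consequently, $$F_R(N)\simeq\log N,\qquad G_R(\ell)\simeq\log(\ell^{-1}),$$ so $R$ is intermittent both in the sense of high-pass filtering, i.e. $\lim_{N\to+\infty}F_R(N)=+\infty$, and in the sense of structure functions, i.e. $\lim_{\ell\to0}G_R(\ell)=+\infty$.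
   Context: $\mathbb{T}=\mathbb{R}/\mathbb{Z}$ is the circle, identified with $[0,1]$ with Lebesgue measure, and $L^p(\mathbb{T})$ denotes the usual Lebesgue space. For a function $f(x)=\sum_{n\in\mathbb{Z}}a_n e^{2\pi i n x}$ on $\mathbb{T}$ with absolutely convergent Fourier series and $N\in\mathbb{N}$, the high-pass filter is $f_{\geq N}(x)=\sum_{|n|\geq N}a_n e^{2\pi i n x}$. (For $R$ the $k$-th Fourier coefficient is $1/k$ if $k\ge 1$ is a perfect square and $0$ otherwise, so $R_{\geq N}(x)=\sum_{m\geq 1,\ m^2\geq N} e^{2\pi i m^2x}/m^2$.) The flatness in the sense of high-pass filtering is $$F_f(N)=\frac{\lVert f_{\geq N}\rVert_{L^4(\mathbb{T})}^4}{\lVert f_{\geq N}\rVert_{L^2(\mathbb{T})}^4}.$$ For $p\geq1$, $\ell\in[0,1]$, the structure functions of $f$ are $S_{f,p}(\ell)=\int_{\mathbb{T}}|f(x+\ell)-f(x)|^p\,dx$, and the flatness in the sense of structure functions is $$G_f(\ell)=\frac{S_{f,4}(\ell)}{S_{f,2}(\ell)^2}.$$ For positive quantities $A,B$ depending on $N$ (resp. $\ell$), $A\simeq B$ means that there are constants $0<c\leq C$, independent of $N$ (resp. $\ell$), with $cB\leq A\leq CB$ for all $N$ (resp. $\ell$) in the stated range. *)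

theory Defs
  imports "HOL-Analysis.Analysis"
begin

text \<open>Functions on the circle are represented by 1-periodic functions on the real line, and
  integrals over the circle by integrals over \<open>{0..1}\<close>.\<close>

definition circle_integral :: "(real \<Rightarrow> 'a::{banach,second_countable_topology}) \<Rightarrow> 'a" where
  "circle_integral f = (LINT x:{0..1}|lborel. f x)"

definition Lp_norm :: "real \<Rightarrow> (real \<Rightarrow> complex) \<Rightarrow> real" where
  "Lp_norm p f = (circle_integral (\<lambda>x. norm (f x) powr p)) powr (1 / p)"

definition fourier_char :: "int \<Rightarrow> real \<Rightarrow> complex" where
  "fourier_char n x = exp (2 * of_real pi * \<i> * of_int n * of_real x)"

definition fourier_coeff :: "(real \<Rightarrow> complex) \<Rightarrow> int \<Rightarrow> complex" where
  "fourier_coeff f n = circle_integral (\<lambda>x. f x * fourier_char (- n) x)"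

text \<open>Meant for functions with absolutely convergent Fourier series: \<^const>\<open>infsum\<close> is \<open>0\<close>
  when the family is not summable.\<close>

definition high_pass :: "(real \<Rightarrow> complex) \<Rightarrow> nat \<Rightarrow> real \<Rightarrow> complex" where
  "high_pass f N x = (\<Sum>\<^sub>\<infinity>n\<in>{n. \<bar>n\<bar> \<ge> int N}. fourier_coeff f n * fourier_char n x)"

definition filter_flatness :: "(real \<Rightarrow> complex) \<Rightarrow> nat \<Rightarrow> real" where
  "filter_flatness f N = Lp_norm 4 (high_pass f N) ^ 4 / Lp_norm 2 (high_pass f N) ^ 4"

definition structure_fun :: "(real \<Rightarrow> complex) \<Rightarrow> real \<Rightarrow> real \<Rightarrow> real" where
  "structure_fun f p l = circle_integral (\<lambda>x. norm (f (x + l) - f x) powr p)"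

definition structure_flatness :: "(real \<Rightarrow> complex) \<Rightarrow> real \<Rightarrow> real" where
  "structure_flatness f l = structure_fun f 4 l / (structure_fun f 2 l)\<^sup>2"

text \<open>Two-sided comparability of positive quantities, with constants uniform over the parameter
  range \<open>S\<close>.\<close>

definition comparable_on :: "'a set \<Rightarrow> ('a \<Rightarrow> real) \<Rightarrow> ('a \<Rightarrow> real) \<Rightarrow> bool" where
  "comparable_on S A B \<longleftrightarrow>
     (\<forall>t\<in>S. 0 < A t \<and> 0 < B t) \<and>
     (\<exists>c C. 0 < c \<and> c \<le> C \<and> (\<forall>t\<in>S. c * B t \<le> A t \<and> A t \<le> C * B t))"

definition riemann_fun :: "real \<Rightarrow> complex" where
  "riemann_fun x = (\<Sum>n. fourier_char (int (Suc n) ^ 2) x / of_nat (Suc n) ^ 2)"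

end

theory Submission
  imports Defs
begin

text \<open>After a translation, both \<open>R\<^sub>\<ge>\<^sub>N\<close> and \<open>R(x + l) - R(x)\<close> are, up to a unimodular constant, of
  the form \<open>\<Sum>\<^sub>m t\<^sub>m e(m\<^sup>2 x)\<close> with real weights \<open>t\<^sub>m\<close>: in the second case the weights are
  \<open>2 sin(\<pi> m\<^sup>2 l)/m\<^sup>2\<close>. In both cases there is a scale \<open>M\<close> (about \<open>N\<^bsup>1/2\<^esup>\<close>, resp. \<open>l\<^bsup>-1/2\<^esup>\<close>) with
  \<open>\<bar>t\<^sub>m\<bar> \<lesssim> 1/(M + m)\<^sup>2\<close>, \<open>t\<^sub>m \<ge> 0\<close> for \<open>m \<le> 60M\<close> and \<open>t\<^sub>m \<gtrsim> 1/M\<^sup>2\<close> for \<open>M \<le> m \<le> 42M\<close>. Parseval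
  gives \<open>\<Sum> t\<^sub>m\<^sup>2 \<simeq> M\<^bsup>-3\<^esup>\<close> for the second moment. The fourth moment is \<open>\<Sum>\<^sub>k (\<Sum> t\<^sub>m t\<^sub>n)\<^sup>2\<close>, the inner sum
  running over \<open>m\<^sup>2 + n\<^sup>2 = k\<close>, so it is a weighted count of the solutions of
  \<open>m\<^sup>2 + n\<^sup>2 = p\<^sup>2 + q\<^sup>2\<close>. Writing \<open>m - p = ab\<close>, \<open>m + p = cd\<close>, \<open>q - n = ac\<close>, \<open>q + n = bd\<close> with \<open>b\<close>, \<open>c\<close>
  coprime forces \<open>a \<le> d\<close>, and summing over \<open>a\<close>, \<open>b\<close>, \<open>c\<close> leaves \<open>M\<^bsup>-6\<^esup> \<Sum>\<^sub>d 1/d \<simeq> M\<^bsup>-6\<^esup> log M\<close>.\<close>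

section \<open>Coincidences of sums of two squares\<close>

text \<open>Squaring a fibre sum produces the ordered pairs inside that fibre, and the fibres
  partition the pairs on which \<open>f\<close> agrees. Sums of squared representation counts thus
  become counts of coincidences.\<close>

lemma sum_fibre_squares:
  fixes g :: "'a \<Rightarrow> real"
  assumes "finite A" "finite S" "f ` A \<subseteq> S"
  shows "(\<Sum>k\<in>S. (\<Sum>i\<in>{i\<in>A. f i = k}. g i)\<^sup>2) =
         (\<Sum>(i,j)\<in>{(i,j)\<in>A \<times> A. f i = f j}. g i * g j)"
proof -
  have "(\<Sum>(i,j)\<in>{(i,j)\<in>A \<times> A. f i = f j}. g i * g j)
      = (\<Sum>k\<in>S. \<Sum>(i,j)\<in>{x\<in>{(i,j)\<in>A \<times> A. f i = f j}. f (fst x) = k}. g i * g j)"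
    using assms by (intro sum.group[symmetric])
      (auto intro: finite_subset[of _ "A \<times> A"])
  also have "\<dots> = (\<Sum>k\<in>S. (\<Sum>i\<in>{i\<in>A. f i = k}. g i)\<^sup>2)"
  proof (rule sum.cong[OF refl])
    fix k
    have "{x\<in>{(i,j)\<in>A \<times> A. f i = f j}. f (fst x) = k} = {i\<in>A. f i = k} \<times> {i\<in>A. f i = k}"
      by auto
    then show "(\<Sum>(i,j)\<in>{x\<in>{(i,j)\<in>A \<times> A. f i = f j}. f (fst x) = k}. g i * g j) =
       (\<Sum>i\<in>{i\<in>A. f i = k}. g i)\<^sup>2"
      by (simp add: power2_eq_square sum_product sum.cartesian_product)
  qed
  finally show ?thesis by simp
qed

text \<open>Solutions are ordered, and the trivial ones, where \<open>(p, q)\<close> is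
  \<open>(m, n)\<close> or its swap, are included.\<close>

definition sq_quads :: "nat set \<Rightarrow> ((nat \<times> nat) \<times> (nat \<times> nat)) set" where
  "sq_quads A = {((m, n), (p, q)). m \<in> A \<and> n \<in> A \<and> p \<in> A \<and> q \<in> A \<and> m\<^sup>2 + n\<^sup>2 = p\<^sup>2 + q\<^sup>2}"

lemma finite_sq_quads: "finite A \<Longrightarrow> finite (sq_quads A)"
  by (rule finite_subset[of _ "(A \<times> A) \<times> (A \<times> A)"]) (auto simp: sq_quads_def)

lemma sum_sq_quads:
  fixes t :: "nat \<Rightarrow> real"
  assumes "finite A" "finite S" "\<And>m n. m \<in> A \<Longrightarrow> n \<in> A \<Longrightarrow> m\<^sup>2 + n\<^sup>2 \<in> S"
  shows "(\<Sum>k\<in>S. (\<Sum>(m,n)\<in>{(m,n)\<in>A \<times> A. m\<^sup>2 + n\<^sup>2 = k}. t m * t n)\<^sup>2) =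
         (\<Sum>((m,n),(p,q))\<in>sq_quads A. t m * t n * (t p * t q))"
proof -
  have "(\<Sum>k\<in>S. (\<Sum>i\<in>{i\<in>A\<times>A. (\<lambda>(m,n). m\<^sup>2 + n\<^sup>2) i = k}. (\<lambda>(m,n). t m * t n) i)\<^sup>2)
     = (\<Sum>(i,j)\<in>{(i,j)\<in>(A\<times>A) \<times> (A\<times>A). (\<lambda>(m,n). m\<^sup>2 + n\<^sup>2) i = (\<lambda>(m,n). m\<^sup>2 + n\<^sup>2) j}.
         (\<lambda>(m,n). t m * t n) i * (\<lambda>(m,n). t m * t n) j)"
    using assms by (intro sum_fibre_squares) auto
  also have "{(i,j)\<in>(A\<times>A) \<times> (A\<times>A). (\<lambda>(m,n). m\<^sup>2 + n\<^sup>2) i = (\<lambda>(m,n). m\<^sup>2 + n\<^sup>2) j} = sq_quads A"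
    by (auto simp: sq_quads_def)
  also have "(\<Sum>(i,j)\<in>sq_quads A. (\<lambda>(m,n). t m * t n) i * (\<lambda>(m,n). t m * t n) j)
     = (\<Sum>((m,n),(p,q))\<in>sq_quads A. t m * t n * (t p * t q))"
    by (intro sum.cong) auto
  also have "(\<lambda>k. {i\<in>A\<times>A. (\<lambda>(m,n). m\<^sup>2 + n\<^sup>2) i = k}) = (\<lambda>k. {(m,n)\<in>A \<times> A. m\<^sup>2 + n\<^sup>2 = k})"
    by auto
  finally show ?thesis by simp
qed

text \<open>Take \<open>a = gcd (m - p) (q - n)\<close>. Cancelling it in
  \<open>(m - p) * (m + p) = (q - n) * (q + n)\<close> leaves
  \<open>b * (m + p) = c * (q + n)\<close> with \<open>b\<close>, \<open>c\<close> coprime, so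
  \<open>c\<close> divides \<open>m + p\<close>, and \<open>d\<close> is the quotient.\<close>

lemma sum_squared_quads_factorization:
  fixes m n p q :: nat
  assumes eq: "m\<^sup>2 + n\<^sup>2 = p\<^sup>2 + q\<^sup>2" and "p < m" "0 < p"
  obtains a b c d where "m - p = a * b" "m + p = c * d" "q - n = a * c" "q + n = b * d"
    "n < q" "0 < a" "a \<le> d" "0 < b" "0 < c"
proof -
  have "p\<^sup>2 < m\<^sup>2" using assms by (simp add: power_strict_mono)
  then have "n\<^sup>2 < q\<^sup>2" using eq by linarith
  then have nq: "n < q" by (simp add: power_less_imp_less_base)
  obtain a b c where g: "m - p = b * a" "q - n = c * a" "coprime b c"
    using gcd_coprime_exists[of "m - p" "q - n"] assms by (metis gcd_eq_0_iff not_less zero_less_diff less_irrefl)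
  have pos: "0 < a" "0 < b" "0 < c"
    using g nq \<open>p < m\<close> by (auto intro!: Nat.gr0I)
  have "(m - p) * (m + p) = (q - n) * (q + n)"
  proof -
    have "int (m - p) * int (m + p) = int (q - n) * int (q + n)"
      using eq nq \<open>p < m\<close>
      by (simp add: of_nat_diff algebra_simps power2_eq_square) (metis of_nat_add of_nat_mult add.commute)
    then show ?thesis by (metis of_nat_eq_iff of_nat_mult)
  qed
  then have bc: "b * (m + p) = c * (q + n)"
    using g pos by (simp add: ac_simps)
  then have "c dvd m + p"
    using g(3) by (metis coprime_commute coprime_dvd_mult_right_iff dvd_triv_left)
  then obtain d where d: "m + p = c * d" by (auto elim: dvdE)
  then have d2: "q + n = b * d" using bc pos by (simp add: ac_simps)
  have l1: "a * b \<le> c * d" using g(1) d by (metis le_add1 le_diff_conv mult.commute trans_le_add1 diff_le_self order.trans)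
  have l2: "a * c \<le> b * d" using g(2) d2 by (metis diff_le_self le_add1 mult.commute order.trans)
  \<comment> \<open>If \<open>b \<le> c\<close>, then \<open>a * c \<le> b * d \<le> c * d\<close>;
    otherwise \<open>a * b \<le> c * d \<le> b * d\<close>.\<close>
  have "a \<le> d"
  proof (cases "b \<le> c")
    case True
    have "a * c \<le> c * d" using l2 True by (meson mult_le_mono1 order.trans)
    then show ?thesis using pos by (simp add: mult.commute)
  next
    case False
    then have "a * b \<le> b * d" using l1 by (meson mult_le_mono1 order.trans nat_le_linear)
    then show ?thesis using pos by (simp add: mult.commute)
  qed
  then show ?thesis using that[of a b c d] g d d2 nq pos by (simp add: mult.commute)
qed

section \<open>Upper bound for the weighted number of solutions\<close>

lemma sum_telescope_le:
  fixes f :: "nat \<Rightarrow> real"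
  assumes "\<And>c. c \<ge> 1 \<Longrightarrow> f c \<le> g (c - 1) - g c" "g n \<ge> 0"
  shows "sum f {1..n} \<le> g 0"
proof -
  have "sum f {1..n} \<le> g 0 - g n"
  proof (induction n)
    case (Suc n)
    then show ?case using assms(1)[of "Suc n"] by simp
  qed simp
  then show ?thesis using assms(2) by linarith
qed

text \<open>Midpoint comparison: \<open>1 / x\<^sup>2\<close> is at most
  \<open>1 / ((x - d/2) * (x + d/2))\<close>, which telescopes. The bound is of order
  \<open>1 / (d * K)\<close> for small \<open>d\<close> and \<open>1 / d\<^sup>2\<close> for large
  \<open>d\<close>; both regimes matter later.\<close>

lemma sum_inverse_square_shift_le:
  fixes K d :: real
  assumes "K > 0" "d > 0"
  shows "(\<Sum>c=1..n. 1 / (K + real c * d)\<^sup>2) \<le> 2 / (d * (2 * K + d))"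
proof -
  have "(\<Sum>c=1..n. 1 / (K + real c * d)\<^sup>2) \<le> (\<lambda>c. 1 / (d * (K + real c * d + d/2))) 0"
  proof (rule sum_telescope_le)
    fix c :: nat assume "c \<ge> 1"
    define x where "x = K + real c * d"
    have x: "x > d" using assms \<open>c \<ge> 1\<close>
      by (smt (verit) x_def mult_le_cancel_right1 of_nat_1 of_nat_le_iff)
    have "1 / x\<^sup>2 \<le> 1 / ((x - d/2) * (x + d/2))"
    proof (intro divide_left_mono)
      show "(x - d / 2) * (x + d / 2) \<le> x\<^sup>2" by (simp add: power2_eq_square algebra_simps)
    qed (use x assms in auto)
    also have "\<dots> = 1 / (d * (x - d/2)) - 1 / (d * (x + d/2))"
      using x assms by (simp add: divide_simps)
    finally show "1 / (K + real c * d)\<^sup>2 \<le> 1 / (d * (K + real (c - 1) * d + d/2)) - 1 / (d * (K + real c * d + d/2))"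
      using \<open>c \<ge> 1\<close> by (simp add: x_def of_nat_diff algebra_simps)
  qed (use assms in auto)
  also have "\<dots> = 2 / (d * (2 * K + d))" using assms by (simp add: divide_simps)
  finally show ?thesis .
qed

text \<open>Partial fractions give the exact value
  \<open>(harm D + harm K - harm (D + K)) / K\<close>. The bound is uniform in \<open>D\<close>, and
  it is where the logarithm in the fourth moment comes from.\<close>

lemma sum_inverse_shift_harm:
  assumes "K > 0"
  shows "(\<Sum>d=1..D. 1 / (real d * (real d + real K))) \<le> harm K / real K"
proof -
  have eq: "(\<Sum>d=1..D. 1 / (real d * (real d + real K))) = (harm D + harm K - harm (D + K)) / real K"
  proof (induction D)
    case (Suc D)
    have "(\<Sum>d=1..Suc D. 1 / (real d * (real d + real K)))
       = (harm D + harm K - harm (D + K)) / real K + 1 / (real (Suc D) * (real (Suc D) + real K))"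
      using Suc by simp
    also have "1 / (real (Suc D) * (real (Suc D) + real K)) = (1 / real (Suc D) - 1 / real (Suc D + K)) / real K"
      using assms by (simp add: divide_simps)
    also have "(harm D + harm K - harm (D + K)) / real K + (1 / real (Suc D) - 1 / real (Suc D + K)) / real K
       = (harm (Suc D) + harm K - harm (Suc D + K)) / real K"
      by (simp add: harm_Suc add_divide_distrib[symmetric] inverse_eq_divide)
    finally show ?case .
  qed (use assms in \<open>simp add: harm_def\<close>)
  have "harm D \<le> (harm (D + K) :: real)"
    unfolding harm_def by (intro sum_mono2) auto
  then show ?thesis unfolding eq by (simp add: divide_right_mono)
qed

text \<open>The solutions with \<open>m = p\<close> also have \<open>n = q\<close> and contribute at
  most \<open>1 / M ^ 6\<close>. Those with \<open>p < m\<close> are parametrised by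
  \<open>(d, a, b, c)\<close>: the choices of \<open>a \<le> d\<close> give a factor
  \<open>d\<close>, and the sums over \<open>b\<close> and \<open>c\<close> give at most
  \<open>8 / (d * (d + 4 * M))\<close> each. The case \<open>m < p\<close> is symmetric. The bound
  does not depend on \<open>K\<close>, which allows passing to infinite series.\<close>

lemma sum_sq_quads_upper:
  fixes M K :: nat
  assumes M: "M > 0"
  defines "v \<equiv> \<lambda>m. 1 / (real M + real m)\<^sup>2"
  shows "(\<Sum>((m,n),(p,q))\<in>sq_quads {1..K}. v m * v n * (v p * v q))
           \<le> (1 + 8 * harm (4 * M)) / real M ^ 6"
proof -
  define g where "g = (\<lambda>((m,n),(p,q)). v m * v n * (v p * v q))"
  define I where "I = {1..K}"
  have v0: "0 \<le> v m" for m by (simp add: v_def)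
  have vM: "v m \<le> 1 / real M ^ 2" for m
    unfolding v_def using M by (intro divide_left_mono power_mono) auto
  have vsum: "sum v I \<le> 1 / real M"
  proof -
    have "sum v I \<le> 2 / (1 * (2 * real M + 1))"
      using sum_inverse_square_shift_le[of "real M" 1 K] M by (simp add: v_def I_def)
    also have "\<dots> \<le> 1 / real M" using M by (simp add: divide_simps)
    finally show ?thesis .
  qed
  define S0 where "S0 = {((m,n),(p,q)). ((m,n),(p,q)) \<in> sq_quads I \<and> m = p}"
  define S1 where "S1 = {((m,n),(p,q)). ((m,n),(p,q)) \<in> sq_quads I \<and> p < m}"
  define S2 where "S2 = {((m,n),(p,q)). ((m,n),(p,q)) \<in> sq_quads I \<and> m < p}"
  have fin: "finite S0" "finite S1" "finite S2"
    by (rule finite_subset[OF _ finite_sq_quads[of I]]; auto simp: S0_def S1_def S2_def I_def)+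
  have split: "sum g (sq_quads I) = sum g S0 + sum g S1 + sum g S2"
  proof -
    have "sq_quads I = (S0 \<union> S1) \<union> S2" by (auto simp: S0_def S1_def S2_def)
    moreover have "(S0 \<union> S1) \<inter> S2 = {}" "S0 \<inter> S1 = {}" by (auto simp: S0_def S1_def S2_def)
    ultimately show ?thesis using fin by (simp add: sum.union_disjoint)
  qed
  have S0: "sum g S0 \<le> 1 / real M ^ 6"
  proof -
    have "sum g S0 \<le> (\<Sum>(m,n)\<in>I\<times>I. v m * v n * (1 / real M ^ 2 * (1 / real M ^ 2)))"
    proof (rule sum_le_included[where i = "\<lambda>x. (x, x)"])
      have "\<exists>y\<in>I \<times> I. (y, y) = x \<and> g x \<le> (case y of (m, n) \<Rightarrow> v m * v n * (1 / real M ^ 2 * (1 / real M ^ 2)))"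
        if "x \<in> S0" for x
      proof -
        from that obtain m n where x: "x = ((m,n),(m,n))" "m \<in> I" "n \<in> I"
          by (auto simp: S0_def sq_quads_def)
        have "v m * v n * (v m * v n) \<le> v m * v n * (1 / real M ^ 2 * (1 / real M ^ 2))"
          by (intro mult_left_mono mult_mono vM v0 mult_nonneg_nonneg) auto
        then show ?thesis using x by (intro bexI[of _ "(m,n)"]) (auto simp: g_def)
      qed
      then show "\<forall>x\<in>S0. \<exists>y\<in>I \<times> I. (y, y) = x \<and> g x \<le> (case y of (m, n) \<Rightarrow> v m * v n * (1 / real M ^ 2 * (1 / real M ^ 2)))"
        by blast
    qed (use fin in \<open>auto simp: I_def v0\<close>)
    also have "\<dots> = (1 / real M ^ 4) * (sum v I * sum v I)"
      by (simp add: sum_product sum.cartesian_product sum_divide_distrib power4_eq_xxxx power2_eq_square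
           case_prod_unfold mult_ac)
    also have "\<dots> \<le> (1 / real M ^ 4) * ((1 / real M) * (1 / real M))"
      by (intro mult_left_mono mult_mono vsum sum_nonneg v0) auto
    also have "\<dots> = 1 / real M ^ 6" by (simp add: power_numeral_reduce)
    finally show ?thesis .
  qed
  \<comment> \<open>\<open>w d c\<close> is the weight \<open>v\<close> evaluated at the real point
    \<open>c * d / 2\<close>. It dominates \<open>v m\<close> because
    \<open>2 * m = a * b + c * d \<ge> c * d\<close>, and \<open>w d b\<close> dominates
    \<open>v q\<close> likewise.\<close>
  define w where "w = (\<lambda>d c. 4 / (2 * real M + real c * real d)\<^sup>2)"
  have w0: "0 \<le> w d c" for d c by (simp add: w_def)
  define J where "J = (SIGMA d:{1..2*K}. {1..d} \<times> ({1..2*K} \<times> {1..2*K}))"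
  define h where "h = (\<lambda>(d,(a::nat),b,c). 1 / real M ^ 4 * (w d b * w d c))"
  have S1: "sum g S1 \<le> 4 * harm (4 * M) / real M ^ 6"
  proof -
    have "sum g S1 \<le> sum h J"
    \<comment> \<open>The map recovers \<open>m, n, p, q\<close> from the parameters. It only has to
      cover \<open>S1\<close>, so neither injectivity nor the parity of the halved terms
      matters.\<close>
    proof (rule sum_le_included[where i = "\<lambda>(d,a,b,c). (((a*b+c*d) div 2, (b*d-a*c) div 2), ((c*d-a*b) div 2, (a*c+b*d) div 2))"])
      have "\<exists>y\<in>J. (\<lambda>(d,a,b,c). (((a*b+c*d) div 2, (b*d-a*c) div 2), ((c*d-a*b) div 2, (a*c+b*d) div 2))) y = x \<and> g x \<le> h y"
        if "x \<in> S1" for x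
      proof -
        from that obtain m n p q where x: "x = ((m,n),(p,q))" "m \<in> I" "n \<in> I" "p \<in> I" "q \<in> I" "p < m"
          "m\<^sup>2 + n\<^sup>2 = p\<^sup>2 + q\<^sup>2"
          by (auto simp: S1_def sq_quads_def)
        then have "0 < p" by (auto simp: I_def)
        from sum_squared_quads_factorization[OF x(7,6) this]
        obtain a b c d where f: "m - p = a * b" "m + p = c * d" "q - n = a * c" "q + n = b * d"
            "n < q" "0 < a" "a \<le> d" "0 < b" "0 < c" .
        have d0: "0 < d" using f by linarith
        have e: "a*b+c*d = 2*m" "b*d-a*c = 2*n" "c*d-a*b=2*p" "a*c+b*d=2*q"
          using f(1-5) x(6) by linarith+
        have "m \<le> K" "n \<le> K" "p \<le> K" "q \<le> K" using x(2-5) by (auto simp: I_def)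
        then have le: "c * d \<le> 2 * K" "b * d \<le> 2 * K" using f(2,4) by linarith+
        have "d \<le> c * d" "c \<le> c * d" "b \<le> b * d" using d0 f by auto
        then have "d \<le> 2 * K" "c \<le> 2 * K" "b \<le> 2 * K" using le by linarith+
        then have J: "(d,a,b,c) \<in> J" using f d0 by (auto simp: J_def)
        have *: "v k \<le> w d j" if "j * d \<le> 2 * k" for j k
        proof -
          have "real j * real d \<le> 2 * real k" using that
            by (metis of_nat_le_iff of_nat_mult of_nat_numeral)
          then have "v k \<le> 1 / (real M + real j * real d / 2)\<^sup>2"
            unfolding v_def using M by (intro divide_left_mono power_mono mult_pos_pos zero_less_power add_pos_nonneg) auto
          also have "(real M + real j * real d / 2)\<^sup>2 = (2 * real M + real j * real d)\<^sup>2 / 4"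
            by (simp add: power2_eq_square algebra_simps)
          finally show ?thesis by (simp add: w_def)
        qed
        have vq: "v q \<le> w d b" and vm: "v m \<le> w d c"
          by (rule *, use e in linarith)+
        \<comment> \<open>The smaller variables \<open>p\<close> and \<open>n\<close> get the
          trivial bound \<open>1 / M\<^sup>2\<close>; all decay in \<open>b\<close>,
          \<open>c\<close>, \<open>d\<close> comes from \<open>m\<close> and
          \<open>q\<close>.\<close>
        have "v m * v n * (v p * v q) = (v p * v n) * (v q * v m)" by simp
        also have "\<dots> \<le> (1 / real M ^ 2 * (1 / real M ^ 2)) * (w d b * w d c)"
          by (intro mult_mono vM v0 w0 mult_nonneg_nonneg vq vm) auto
        finally have "g x \<le> h (d,a,b,c)"
          by (simp add: g_def h_def x power2_eq_square power4_eq_xxxx)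
        then show ?thesis using J e x by (intro bexI[of _ "(d,a,b,c)"]) auto
      qed
      then show "\<forall>x\<in>S1. \<exists>y\<in>J. (\<lambda>(d,a,b,c). (((a*b+c*d) div 2, (b*d-a*c) div 2), ((c*d-a*b) div 2, (a*c+b*d) div 2))) y = x \<and> g x \<le> h y"
        by blast
    qed (use fin in \<open>auto simp: J_def h_def v0 w0\<close>)
    also have "\<dots> = (\<Sum>d=1..2*K. \<Sum>(a,b,c)\<in>{1..d} \<times> ({1..2*K} \<times> {1..2*K}). h (d,a,b,c))"
      unfolding J_def by (subst sum.Sigma) (auto simp: case_prod_unfold)
    also have "\<dots> = (\<Sum>d=1..2*K. 1 / real M ^ 4 * (real d * (\<Sum>c=1..2*K. w d c)\<^sup>2))"
    proof (rule sum.cong[OF refl])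
      fix d
      have "(\<Sum>(a,b,c)\<in>{1..d} \<times> ({1..2*K} \<times> {1..2*K}). h (d,a,b,c)) =
        (\<Sum>a\<in>{1..d}. \<Sum>b\<in>{1..2*K}. \<Sum>c\<in>{1..2*K}. h (d,a,b,c))"
        by (simp add: sum.cartesian_product)
      also have "\<dots> = 1 / real M ^ 4 * (real d * (\<Sum>c=1..2*K. w d c)\<^sup>2)"
        by (simp add: h_def power2_eq_square sum_product sum_distrib_left mult_ac)
      finally show "(\<Sum>(a,b,c)\<in>{1..d} \<times> ({1..2*K} \<times> {1..2*K}). h (d,a,b,c))
         = 1 / real M ^ 4 * (real d * (\<Sum>c=1..2*K. w d c)\<^sup>2)" .
    qed
    also have "\<dots> \<le> (\<Sum>d=1..2*K. 1 / real M ^ 4 * (16 / real M * (1 / (real d * (real d + real (4 * M))))))"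
    proof (rule sum_mono)
      fix d assume "d \<in> {1..2*K}"
      then have d: "real d \<ge> 1" by auto
      have "(\<Sum>c=1..2*K. w d c) = 4 * (\<Sum>c=1..2*K. 1 / (2 * real M + real c * real d)\<^sup>2)"
        by (simp add: w_def sum_distrib_left)
      also have "\<dots> \<le> 4 * (2 / (real d * (2 * (2 * real M) + real d)))"
        using sum_inverse_square_shift_le[of "2 * real M" "real d" "2*K"] M d by simp
      finally have "(\<Sum>c=1..2*K. w d c) \<le> 8 / (real d * (real d + 4 * real M))" by (simp add: add_ac)
      then have "real d * (\<Sum>c=1..2*K. w d c)\<^sup>2 \<le> real d * (8 / (real d * (real d + 4 * real M)))\<^sup>2"
        by (intro mult_left_mono power_mono sum_nonneg w0) auto
      also have "\<dots> = 64 / (real d + 4 * real M) * (1 / (real d * (real d + 4 * real M)))"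
        using d by (simp add: power2_eq_square)
      \<comment> \<open>Dropping \<open>d\<close> from one factor leaves precisely the summand of
        the harmonic estimate.\<close>
      also have "\<dots> \<le> 64 / (4 * real M) * (1 / (real d * (real d + 4 * real M)))"
        using M d by (intro mult_right_mono divide_left_mono) auto
      finally show "1 / real M ^ 4 * (real d * (\<Sum>c=1..2*K. w d c)\<^sup>2) \<le>
          1 / real M ^ 4 * (16 / real M * (1 / (real d * (real d + real (4 * M)))))"
        by (intro mult_left_mono) auto
    qed
    also have "\<dots> = 1 / real M ^ 4 * (16 / real M * (\<Sum>d=1..2*K. 1 / (real d * (real d + real (4 * M)))))"
      by (simp add: sum_distrib_left)
    also have "\<dots> \<le> 1 / real M ^ 4 * (16 / real M * (harm (4 * M) / real (4 * M)))"
      by (intro mult_left_mono sum_inverse_shift_harm) (use M in auto)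
    also have "\<dots> = 4 * harm (4 * M) / real M ^ 6"
      by (simp add: power_numeral_reduce)
    finally show ?thesis .
  qed
  \<comment> \<open>Exchanging \<open>(m, n)\<close> with \<open>(p, q)\<close> preserves the
    product of weights.\<close>
  have "sum g S2 = sum g S1"
    by (rule sum.reindex_bij_witness[where i = prod.swap and j = prod.swap])
      (auto simp: S1_def S2_def sq_quads_def g_def)
  then have "sum g (sq_quads I) \<le> (1 + 8 * harm (4 * M)) / real M ^ 6"
    using split S0 S1 by (simp add: add_divide_distrib)
  then show ?thesis by (simp add: g_def I_def)
qed

section \<open>Lower bound for the number of solutions\<close>

lemma sum_inverse_squares_from_2: "(\<Sum>g=2..n. 1 / (real g)\<^sup>2) \<le> 13 / 20"
proof -
  \<comment> \<open>The range is enlarged so that the term \<open>g = 2\<close> is always present.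
    It contributes 1/4 exactly, the midpoint bound gives 2/5 for the rest, and 1/4 + 2/5 =
    13/20.\<close>
  have "(\<Sum>g=2..n. 1 / (real g)\<^sup>2) \<le> (\<Sum>g=2..n + 2. 1 / (real g)\<^sup>2)"
    by (intro sum_mono2) auto
  also have "\<dots> = 1 / 4 + (\<Sum>g=1+2..n+2. 1 / (real g)\<^sup>2)"
    using sum.atLeast_Suc_atMost[of 2 "n + 2" "\<lambda>g. 1 / (real g)\<^sup>2"] by (simp add: numeral_3_eq_3)
  also have "(\<Sum>g=1+2..n+2. 1 / (real g)\<^sup>2) = (\<Sum>g=1..n. 1 / (2 + real g * 1)\<^sup>2)"
    unfolding sum.shift_bounds_cl_nat_ivl by (simp add: add.commute)
  also have "\<dots> \<le> 2 / (1 * (2 * 2 + 1))"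
    by (rule sum_inverse_square_shift_le) auto
  finally show ?thesis by simp
qed

text \<open>The cut-offs keep \<open>b\<close> and \<open>c\<close> within a factor 10 of each
  other, so that \<open>20 * e * c\<close> dominates \<open>a * b\<close> for
  \<open>a \<le> e\<close>, and the same with \<open>b\<close> and \<open>c\<close>
  exchanged.\<close>

definition coprime_pairs :: "nat \<Rightarrow> (nat \<times> nat) set" where
  "coprime_pairs B = {(b, c). b \<in> {1..B} \<and> c \<in> {1..B} \<and> coprime b c \<and> B < 10 * b \<and> B < 10 * c}"

lemma finite_coprime_pairs: "finite (coprime_pairs B)"
  unfolding coprime_pairs_def by (rule finite_subset[of _ "{1..B} \<times> {1..B}"]) (blast, simp)

text \<open>The density of non-coprime pairs is at most \<open>\<Sum>\<^sub>g\<^sub>\<ge>\<^sub>2 1/g\<^sup>2 \<le> 0.65\<close>, and the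
  two discarded strips have density \<open>0.1\<close> each.\<close>

lemma card_coprime_pairs: "real (card (coprime_pairs B)) \<ge> 3 / 20 * (real B)\<^sup>2"
proof -
  define D where "D = (\<lambda>g. {b\<in>{1..B}. g dvd b})"
  define L where "L = {b\<in>{1..B}. 10 * b \<le> B}"
  have D: "card (D g) \<le> B div g" if "g > 0" for g
  proof -
    have "D g \<subseteq> (\<lambda>k. g * k) ` {1..B div g}"
    proof
      fix b assume b: "b \<in> D g"
      then obtain k where k: "b = g * k" by (auto simp: D_def elim: dvdE)
      then have "k \<le> B div g" using b that by (auto simp: D_def less_eq_div_iff_mult_less_eq mult.commute)
      then show "b \<in> (\<lambda>k. g * k) ` {1..B div g}" using k b by (auto simp: D_def intro!: imageI)
    qed
    then have "card (D g) \<le> card ((\<lambda>k. g * k) ` {1..B div g})" by (intro card_mono) auto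
    also have "\<dots> \<le> B div g" using card_image_le[of "{1..B div g}" "\<lambda>k. g * k"] by simp
    finally show ?thesis .
  qed
  define Z where "Z = B div 10"
  have Z: "real Z \<le> real B / 10"
  proof -
    have "10 * Z \<le> B" unfolding Z_def by (rule times_div_less_eq_dividend)
    then have "real (10 * Z) \<le> real B" by (rule of_nat_mono)
    then show ?thesis by simp
  qed
  have "L \<subseteq> {1..Z}" unfolding Z_def by (auto simp: L_def)
  then have "card L \<le> card {1..Z}" by (intro card_mono) auto
  then have L: "card L \<le> Z" by simp
  \<comment> \<open>Union bound: a non-coprime pair has a common divisor \<open>g \<ge> 2\<close>,
    and at most \<open>B div g\<close> numbers up to \<open>B\<close> are multiples of
    \<open>g\<close>.\<close>
  have sub: "{1..B} \<times> {1..B} \<subseteq> coprime_pairs B \<union> (\<Union>g\<in>{2..B}. D g \<times> D g) \<union> L \<times> {1..B} \<union> {1..B} \<times> L"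
  proof
    fix x assume "x \<in> {1..B} \<times> {1..B}"
    then obtain b c where x: "x = (b,c)" "b \<in> {1..B}" "c \<in> {1..B}" by auto
    show "x \<in> coprime_pairs B \<union> (\<Union>g\<in>{2..B}. D g \<times> D g) \<union> L \<times> {1..B} \<union> {1..B} \<times> L"
    proof (cases "coprime b c")
      case False
      then obtain g where g: "g dvd b" "g dvd c" "\<not> g dvd 1"
        by (rule not_coprimeE) auto
      then have "g \<noteq> 1" "g \<le> b" "g \<noteq> 0" using x by (auto intro: dvd_imp_le)
      then have "g \<in> {2..B}" using x by auto
      moreover have "(b,c) \<in> D g \<times> D g" using x g by (auto simp: D_def)
      ultimately show ?thesis using x by blast
    next
      case True
      then show ?thesis using x by (auto simp: coprime_pairs_def L_def)
    qed
  qed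
  have fin: "finite (D g)" "finite L" for g by (auto simp: D_def L_def)
  have "B * B = card ({1..B} \<times> {1..B})" by simp
  also have "\<dots> \<le> card (coprime_pairs B \<union> (\<Union>g\<in>{2..B}. D g \<times> D g) \<union> L \<times> {1..B} \<union> {1..B} \<times> L)"
    by (intro card_mono sub) (auto simp: finite_coprime_pairs fin)
  also have "\<dots> \<le> card (coprime_pairs B) + card (\<Union>g\<in>{2..B}. D g \<times> D g) + card (L \<times> {1..B}) + card ({1..B} \<times> L)"
    by (intro order.trans[OF card_Un_le] add_mono order.refl)
  finally have 0: "B * B \<le> card (coprime_pairs B) + card (\<Union>g\<in>{2..B}. D g \<times> D g)
      + card (L \<times> {1..B}) + card ({1..B} \<times> L)" .
  have "card (\<Union>g\<in>{2..B}. D g \<times> D g) \<le> (\<Sum>g=2..B. card (D g \<times> D g))"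
    by (rule card_UN_le) auto
  also have "\<dots> \<le> (\<Sum>g=2..B. (B div g) * (B div g))"
    unfolding card_cartesian_product by (intro sum_mono mult_le_mono D) auto
  finally have "card (\<Union>g\<in>{2..B}. D g \<times> D g) \<le> (\<Sum>g=2..B. (B div g) * (B div g))" .
  moreover have "card (L \<times> {1..B}) \<le> Z * B" "card ({1..B} \<times> L) \<le> Z * B"
    using mult_le_mono1[OF L, of B] by (simp_all only: card_cartesian_product card_atLeastAtMost diff_Suc_1 mult.commute)
  ultimately have "B * B \<le> card (coprime_pairs B) + (\<Sum>g=2..B. (B div g) * (B div g)) + Z * B + Z * B"
    using 0 by linarith
  from of_nat_mono[OF this, where 'a = real]
  have 1: "(real B)\<^sup>2 \<le> real (card (coprime_pairs B)) + (\<Sum>g=2..B. (real (B div g))\<^sup>2)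
      + real Z * real B + real Z * real B"
    by (simp only: of_nat_add of_nat_mult of_nat_sum power2_eq_square)
  have "(\<Sum>g=2..B. (real (B div g))\<^sup>2) \<le> (\<Sum>g=2..B. (real B)\<^sup>2 * (1 / (real g)\<^sup>2))"
  proof (rule sum_mono)
    fix g assume "g \<in> {2..B}"
    have "(real (B div g))\<^sup>2 \<le> (real B / real g)\<^sup>2"
      by (rule power_mono[OF of_nat_div_le_of_nat of_nat_0_le_iff])
    then show "(real (B div g))\<^sup>2 \<le> (real B)\<^sup>2 * (1 / (real g)\<^sup>2)" by (simp add: power_divide)
  qed
  also have "\<dots> = (real B)\<^sup>2 * (\<Sum>g=2..B. 1 / (real g)\<^sup>2)" by (simp add: sum_distrib_left)
  also have "\<dots> \<le> (real B)\<^sup>2 * (13 / 20)"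
    by (intro mult_left_mono sum_inverse_squares_from_2) auto
  finally have 2: "(\<Sum>g=2..B. (real (B div g))\<^sup>2) \<le> (real B)\<^sup>2 * (13 / 20)" .
  have "real Z * real B \<le> (real B / 10) * real B"
    using Z by (rule mult_right_mono) simp
  then have 3: "real Z * real B \<le> (real B)\<^sup>2 / 10" by (simp add: power2_eq_square)
  then have "3 / 20 * (real B)\<^sup>2 \<le> (real B)\<^sup>2 - (real B)\<^sup>2 * (13 / 20) - (real B)\<^sup>2 / 10 - (real B)\<^sup>2 / 10"
    by simp
  also have "\<dots> \<le> real (card (coprime_pairs B))"
    using 1 2 3 by linarith
  finally show ?thesis .
qed

text \<open>Both sides equal \<open>(a\<^sup>2 + d\<^sup>2) * (b\<^sup>2 + c\<^sup>2)\<close>, the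
  Brahmagupta-Fibonacci identity. The assumptions make the truncated subtractions genuine.\<close>

lemma sq_quad_identity:
  fixes a b c d :: nat
  assumes "a * c \<le> b * d" "a * b \<le> c * d"
  shows "(a * b + c * d)\<^sup>2 + (b * d - a * c)\<^sup>2 = (c * d - a * b)\<^sup>2 + (a * c + b * d)\<^sup>2"
proof -
  have "int ((a * b + c * d)\<^sup>2 + (b * d - a * c)\<^sup>2) = int ((c * d - a * b)\<^sup>2 + (a * c + b * d)\<^sup>2)"
    using assms unfolding of_nat_add of_nat_power
    by (simp add: of_nat_diff) (simp add: power2_eq_square algebra_simps)
  then show ?thesis by (simp only: of_nat_eq_iff)
qed

text \<open>The solutions counted below come from the parametrisation with \<open>d = 20e\<close> and \<open>a \<le> e\<close>, which keeps
  all four entries comparable to \<open>M\<close>; coprimality of \<open>b\<close> and \<open>c\<close> makes it injective.\<close>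

lemma card_sq_quads_ge:
  assumes M: "M > 0"
  shows "real (card (sq_quads {M..42 * M})) \<ge> 3 / 20 * (real M)\<^sup>2 * harm M"
proof -
  define J where "J = (SIGMA e:{1..M}. {1..e} \<times> coprime_pairs (2 * M div e))"
  \<comment> \<open>The parametrisation is taken without the factor 1/2, so no parity condition on
    the parameters arises.\<close>
  define f :: "nat \<times> nat \<times> nat \<times> nat \<Rightarrow> (nat \<times> nat) \<times> (nat \<times> nat)"
    where "f = (\<lambda>(e,a,b,c). ((a*b+c*(20*e), b*(20*e)-a*c), (c*(20*e)-a*b, a*c+b*(20*e))))"
  \<comment> \<open>With \<open>B = 2 * M div e\<close> and \<open>e \<le> M\<close>, the product
    \<open>e * B\<close> lies between \<open>M\<close> and \<open>2 * M\<close>. Since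
    \<open>a * b \<le> e * B\<close> and \<open>2 * e * B \<le> 20 * e * c \<le> 20 * e * B\<close>,
    the difference is at least \<open>e * B \<ge> M\<close> and the sum at most
    \<open>21 * e * B \<le> 42 * M\<close>. Allowing either order of \<open>b\<close> and
    \<open>c\<close> covers all four entries.\<close>
  have *: "M \<le> c * (20 * e) - a * b \<and> a * b \<le> c * (20 * e) \<and> a * b + c * (20 * e) \<le> 42 * M"
    if "e \<in> {1..M}" "a \<in> {1..e}" "(b,c) \<in> coprime_pairs (2 * M div e) \<or> (c,b) \<in> coprime_pairs (2 * M div e)"
    for e a b c
  proof -
    define B where "B = 2 * M div e"
    have B: "b \<le> B" "c \<le> B" "B < 10 * c" using that by (auto simp: coprime_pairs_def B_def)
    have "2 * M = e * B + 2 * M mod e" by (simp add: B_def)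
    moreover have "2 * M mod e < e" using that by simp
    moreover have eM: "e \<le> M" using that by simp
    ultimately have eB: "e * B \<le> 2 * M" "M \<le> e * B" by linarith+
    have ab: "a * b \<le> e * B" using B that by (intro mult_mono) auto
    have "e * B \<le> e * (10 * c)" using B by (intro mult_left_mono) auto
    then have l: "2 * (e * B) \<le> c * (20 * e)" by simp
    have "c * (20 * e) \<le> B * (20 * e)" using B by (intro mult_right_mono) auto
    then have u: "c * (20 * e) \<le> 20 * (e * B)" by (simp add: ac_simps)
    show ?thesis using eB ab l u by linarith
  qed
  have sub: "f ` J \<subseteq> sq_quads {M..42 * M}"
  proof
    fix y assume "y \<in> f ` J"
    then obtain e a b c where y: "y = f (e,a,b,c)" and J: "(e,a,b,c) \<in> J" by auto
    have J': "e \<in> {1..M}" "a \<in> {1..e}" "(b,c) \<in> coprime_pairs (2 * M div e)" using J by (auto simp: J_def)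
    have 1: "M \<le> c * (20 * e) - a * b" "a * b \<le> c * (20 * e)" "a * b + c * (20 * e) \<le> 42 * M"
      using *[of e a b c] J' by auto
    have 2: "M \<le> b * (20 * e) - a * c" "a * c \<le> b * (20 * e)" "a * c + b * (20 * e) \<le> 42 * M"
      using *[of e a c b] J' by auto
    show "y \<in> sq_quads {M..42 * M}"
      using 1 2 sq_quad_identity[OF 2(2) 1(2)] by (auto simp: y f_def sq_quads_def)
  qed
  have inj: "inj_on f J"
  proof (rule inj_onI)
    fix x x' assume x: "x \<in> J" "x' \<in> J" "f x = f x'"
    obtain e a b c where xe: "x = (e,a,b,c)" by (cases x) auto
    obtain e' a' b' c' where xe': "x' = (e',a',b',c')" by (cases x') auto
    have J: "e \<in> {1..M}" "a \<in> {1..e}" "(b,c) \<in> coprime_pairs (2 * M div e)"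
      "e' \<in> {1..M}" "a' \<in> {1..e'}" "(b',c') \<in> coprime_pairs (2 * M div e')" using x xe xe' by (auto simp: J_def)
    have pos: "0 < a" "0 < b" "0 < c" "0 < a'" "0 < b'" "0 < c'" "coprime b c" "coprime b' c'"
      using J by (auto simp: coprime_pairs_def)
    have le: "a * b \<le> c * (20 * e)" "a * c \<le> b * (20 * e)" "a' * b' \<le> c' * (20 * e')" "a' * c' \<le> b' * (20 * e')"
      using *[of e a b c] *[of e a c b] *[of e' a' b' c'] *[of e' a' c' b'] J by auto
    have "a*b+c*(20*e) = a'*b'+c'*(20*e')" "b*(20*e)-a*c = b'*(20*e')-a'*c'"
      "c*(20*e)-a*b = c'*(20*e')-a'*b'" "a*c+b*(20*e) = a'*c'+b'*(20*e')"
      using x(3) by (auto simp: f_def xe xe')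
    then have e: "a * b = a' * b'" "a * c = a' * c'" "c * (20 * e) = c' * (20 * e')"
      using le by linarith+
    \<comment> \<open>Sums and differences of the entries determine \<open>a * b\<close>,
      \<open>a * c\<close> and \<open>c * e\<close>; coprimality recovers \<open>a\<close> as a gcd,
      and the other parameters follow by division.\<close>
    have "a = gcd (a * b) (a * c)" "a' = gcd (a' * b') (a' * c')"
      using pos by (simp_all add: gcd_mult_distrib_nat[symmetric])
    then have "a = a'" using e by simp
    then show "x = x'" using e pos by (auto simp: xe xe')
  qed
  have cJ: "card J = (\<Sum>e=1..M. e * card (coprime_pairs (2 * M div e)))"
    unfolding J_def by (subst card_SigmaI) (auto simp: finite_coprime_pairs card_cartesian_product)
  have "3 / 20 * (real M)\<^sup>2 * harm M = (\<Sum>e=1..M. 3 / 20 * (real M)\<^sup>2 * inverse (real e))"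
    by (simp add: harm_def sum_distrib_left)
  \<comment> \<open>There are \<open>e\<close> choices of \<open>a\<close> and at least
    \<open>3/20 * (M / e)\<^sup>2\<close> pairs, hence a multiple of \<open>M\<^sup>2 / e\<close>: a
    harmonic sum over \<open>e\<close>.\<close>
  also have "\<dots> \<le> (\<Sum>e=1..M. real e * real (card (coprime_pairs (2 * M div e))))"
  proof (rule sum_mono)
    fix e assume e: "e \<in> {1..M}"
    have "M \<le> e * (2 * M div e)"
    proof -
      have "2 * M = e * (2 * M div e) + 2 * M mod e" by simp
      moreover have "2 * M mod e < e" using e by simp
      moreover have "e \<le> M" using e by simp
      ultimately show ?thesis by linarith
    qed
    then have "real M \<le> real e * real (2 * M div e)" by (metis of_nat_le_iff of_nat_mult)
    then have "real M / real e \<le> real (2 * M div e)" using e by (simp add: field_simps)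
    then have "3 / 20 * (real M / real e)\<^sup>2 \<le> 3 / 20 * (real (2 * M div e))\<^sup>2"
      by (intro mult_left_mono power_mono) auto
    also have "\<dots> \<le> real (card (coprime_pairs (2 * M div e)))" by (rule card_coprime_pairs)
    finally have "real e * (3 / 20 * (real M / real e)\<^sup>2) \<le> real e * real (card (coprime_pairs (2 * M div e)))"
      by (intro mult_left_mono) auto
    moreover have "real e * (3 / 20 * (real M / real e)\<^sup>2) = 3 / 20 * (real M)\<^sup>2 * inverse (real e)"
      using e by (simp add: power2_eq_square field_simps)
    ultimately show "3 / 20 * (real M)\<^sup>2 * inverse (real e) \<le> real e * real (card (coprime_pairs (2 * M div e)))"
      by simp
  qed
  also have "\<dots> = real (card J)" by (simp add: cJ)
  also have "card J \<le> card (sq_quads {M..42 * M})"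
    by (rule card_inj_on_le[OF inj sub]) (simp add: finite_sq_quads)
  finally show ?thesis by simp
qed

section \<open>Trigonometric series with square frequencies\<close>

lemma fourier_char_cis: "fourier_char n x = cis (2 * pi * of_int n * x)"
  by (simp add: fourier_char_def cis_conv_exp mult_ac)

lemma norm_fourier_char [simp]: "norm (fourier_char n x) = 1"
  by (simp add: fourier_char_cis)

lemma fourier_char_0 [simp]: "fourier_char 0 x = 1"
  by (simp add: fourier_char_cis)

lemma fourier_char_add: "fourier_char (m + n) x = fourier_char m x * fourier_char n x"
  by (simp add: fourier_char_cis cis_mult ring_distribs)

lemma fourier_char_add_right: "fourier_char n (x + y) = fourier_char n x * fourier_char n y"
  by (simp add: fourier_char_cis cis_mult ring_distribs)

lemma cnj_fourier_char: "cnj (fourier_char n x) = fourier_char (- n) x"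
  by (simp add: fourier_char_cis cis_cnj)

lemma fourier_char_1 [simp]: "fourier_char n 1 = 1"
  using cis_multiple_2pi[of "of_int n"] by (simp add: fourier_char_cis)

lemma continuous_on_fourier_char [continuous_intros]:
  "continuous_on S g \<Longrightarrow> continuous_on S (\<lambda>x. fourier_char n (g x))"
  unfolding fourier_char_def by (intro continuous_intros) auto

lemma integrable_indicator_continuous:
  fixes f :: "real \<Rightarrow> 'a::{banach,second_countable_topology}"
  assumes "continuous_on UNIV f"
  shows "integrable lborel (\<lambda>x. indicator {0..1} x *\<^sub>R f x)"
  using borel_integrable_atLeastAtMost'[of 0 1 f] continuous_on_subset[OF assms]
  unfolding set_integrable_def by auto

lemma circle_integral_sum:
  fixes f :: "'b \<Rightarrow> real \<Rightarrow> 'a::{banach,second_countable_topology}"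
  assumes "\<And>i. i \<in> A \<Longrightarrow> continuous_on UNIV (f i)"
  shows "circle_integral (\<lambda>x. \<Sum>i\<in>A. f i x) = (\<Sum>i\<in>A. circle_integral (f i))"
  unfolding circle_integral_def set_lebesgue_integral_def scaleR_sum_right
  by (intro Bochner_Integration.integral_sum integrable_indicator_continuous assms)

lemma circle_integral_mult_right:
  fixes c :: complex
  shows "circle_integral (\<lambda>x. c * f x) = c * circle_integral f"
  unfolding circle_integral_def by (rule set_integral_mult_right)

lemma circle_integral_of_real: "circle_integral (\<lambda>x. complex_of_real (f x)) = of_real (circle_integral f)"
  unfolding circle_integral_def set_lebesgue_integral_def
  by (subst integral_complex_of_real[symmetric]) (simp add: scaleR_conv_of_real)

lemma circle_integral_fourier_char: "circle_integral (fourier_char n) = (if n = 0 then 1 else 0)"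
proof (cases "n = 0")
  case True
  then show ?thesis
    by (simp add: circle_integral_def set_lebesgue_integral_def)
next
  case False
  define c where "c = 2 * of_real pi * \<i> * of_int n"
  have c: "c \<noteq> 0" using False by (simp add: c_def)
  have "((\<lambda>x. exp (c * of_real x) / c) has_vector_derivative fourier_char n x) (at x within {0..1})" for x
  proof -
    have "((\<lambda>z. exp (c * z) / c) has_field_derivative exp (c * of_real x)) (at (of_real x))"
      using c by (auto intro!: derivative_eq_intros)
    from has_vector_derivative_real_field[OF this, of "{0..1}"]
    show ?thesis by (simp add: fourier_char_def c_def o_def)
  qed
  then have "circle_integral (fourier_char n) = exp (c * of_real 1) / c - exp (c * of_real 0) / c"
    unfolding circle_integral_def set_lebesgue_integral_def
    by (intro integral_FTC_Icc) (auto intro!: continuous_intros)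
  also have "exp (c * of_real 1) = fourier_char n 1" by (simp add: fourier_char_def c_def)
  also have "\<dots> / c - exp (c * of_real 0) / c = 0" by simp
  finally show ?thesis using False by simp
qed

lemma circle_integral_fourier_char_shift:
  "circle_integral (\<lambda>x. fourier_char n (x + s)) = (if n = 0 then 1 else 0)"
  unfolding fourier_char_add_right mult.commute[of "fourier_char n _" "fourier_char n s"]
  by (simp add: circle_integral_mult_right circle_integral_fourier_char)

text \<open>Expanding the square of the modulus, orthogonality leaves the diagonal because the
  frequencies are distinct. The frequency map is general because the lemma serves both for the sum
  itself, with frequencies \<open>m\<^sup>2\<close>, and for its square, with frequencies
  \<open>k\<close>.\<close>

lemma parseval_trig_sum:
  fixes c :: "'a \<Rightarrow> real"
  assumes "finite A" "inj_on \<phi> A"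
  shows "circle_integral (\<lambda>x. (norm (\<Sum>i\<in>A. of_real (c i) * fourier_char (\<phi> i) (x + s)))\<^sup>2)
           = (\<Sum>i\<in>A. (c i)\<^sup>2)"
proof -
  have "complex_of_real (circle_integral (\<lambda>x. (norm (\<Sum>i\<in>A. of_real (c i) * fourier_char (\<phi> i) (x + s)))\<^sup>2))
     = circle_integral (\<lambda>x. \<Sum>i\<in>A. \<Sum>j\<in>A. of_real (c i * c j) * fourier_char (\<phi> i - \<phi> j) (x + s))"
    unfolding circle_integral_of_real[symmetric]
  proof (rule arg_cong[where f = circle_integral], rule ext)
    fix x
    have "complex_of_real ((norm (\<Sum>i\<in>A. of_real (c i) * fourier_char (\<phi> i) (x + s)))\<^sup>2)
      = (\<Sum>i\<in>A. of_real (c i) * fourier_char (\<phi> i) (x + s)) * (\<Sum>j\<in>A. of_real (c j) * fourier_char (- \<phi> j) (x + s))"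
      by (subst complex_norm_square) (simp add: cnj_fourier_char)
    also have "\<dots> = (\<Sum>i\<in>A. \<Sum>j\<in>A. of_real (c i * c j) * fourier_char (\<phi> i - \<phi> j) (x + s))"
      unfolding sum_product diff_conv_add_uminus fourier_char_add
      by (intro sum.cong) auto
    finally show "complex_of_real ((norm (\<Sum>i\<in>A. of_real (c i) * fourier_char (\<phi> i) (x + s)))\<^sup>2)
      = (\<Sum>i\<in>A. \<Sum>j\<in>A. of_real (c i * c j) * fourier_char (\<phi> i - \<phi> j) (x + s))" .
  qed
  also have "\<dots> = (\<Sum>i\<in>A. \<Sum>j\<in>A. of_real (c i * c j) * (if \<phi> i - \<phi> j = 0 then 1 else 0))"
    by (simp only: circle_integral_sum circle_integral_mult_right circle_integral_fourier_char_shift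
          continuous_intros)
  also have "\<dots> = (\<Sum>i\<in>A. \<Sum>j\<in>A. if i = j then of_real (c i * c j) else 0)"
    using assms by (intro sum.cong refl) (auto dest: inj_onD)
  also have "\<dots> = of_real (\<Sum>i\<in>A. (c i)\<^sup>2)"
    using assms by (simp add: power2_eq_square)
  finally show ?thesis by (simp only: of_real_eq_iff)
qed

section \<open>Finite moments and passage to the limit\<close>

definition sq_trig_sum :: "(nat \<Rightarrow> real) \<Rightarrow> real \<Rightarrow> nat \<Rightarrow> real \<Rightarrow> complex" where
  "sq_trig_sum t s K x = (\<Sum>m=1..K. of_real (t m) * fourier_char (int m ^ 2) (x + s))"

text \<open>The shift \<open>s\<close> accommodates the midpoint \<open>x + l / 2\<close> that
  appears in increments of \<open>riemann_fun\<close>. Indexing by \<open>Suc n\<close> starts the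
  series at \<open>m = 1\<close>.\<close>

definition sq_trig_series :: "(nat \<Rightarrow> real) \<Rightarrow> real \<Rightarrow> real \<Rightarrow> complex" where
  "sq_trig_series t s x = (\<Sum>n. of_real (t (Suc n)) * fourier_char (int (Suc n) ^ 2) (x + s))"

lemma continuous_on_sq_trig_sum: "continuous_on S (sq_trig_sum t s K)"
  unfolding sq_trig_sum_def by (intro continuous_intros)

lemma circle_integral_sq_trig_sum_power2:
  "circle_integral (\<lambda>x. norm (sq_trig_sum t s K x) ^ 2) = (\<Sum>m=1..K. (t m)\<^sup>2)"
  unfolding sq_trig_sum_def
  by (rule parseval_trig_sum) (auto simp: inj_on_def power2_eq_iff_nonneg)

text \<open>The fourth power is the squared modulus of the square of the sum. That square is again a
  trigonometric sum, whose coefficient at \<open>k\<close> collects the products over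
  \<open>m\<^sup>2 + n\<^sup>2 = k\<close>, so Parseval applies to it.\<close>

lemma circle_integral_sq_trig_sum_power4:
  "circle_integral (\<lambda>x. norm (sq_trig_sum t s K x) ^ 4) =
     (\<Sum>k\<le>2 * K\<^sup>2. (\<Sum>(m,n)\<in>{(m,n)\<in>{1..K} \<times> {1..K}. m\<^sup>2 + n\<^sup>2 = k}. t m * t n)\<^sup>2)"
proof -
  have "norm (sq_trig_sum t s K x) ^ 4 =
     (norm (\<Sum>k\<le>2 * K\<^sup>2. complex_of_real (\<Sum>(m,n)\<in>{(m,n)\<in>{1..K} \<times> {1..K}. m\<^sup>2 + n\<^sup>2 = k}. t m * t n)
         * fourier_char (int k) (x + s)))\<^sup>2" for x
  proof -
    let ?g = "\<lambda>(m,n). of_real (t m * t n) * fourier_char (int (m\<^sup>2 + n\<^sup>2)) (x + s)"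
    have "(sq_trig_sum t s K x)\<^sup>2 = sum ?g ({1..K} \<times> {1..K})"
      unfolding sq_trig_sum_def power2_eq_square[of "sum _ _"] sum_product sum.cartesian_product
      by (intro sum.cong) (auto simp: fourier_char_add)
    also have "\<dots> = (\<Sum>k\<le>2 * K\<^sup>2. sum ?g {z\<in>{1..K} \<times> {1..K}. (\<lambda>(m,n). m\<^sup>2 + n\<^sup>2) z = k})"
    proof (rule sum.group[symmetric])
      show "(\<lambda>(m,n). m\<^sup>2 + n\<^sup>2) ` ({1..K} \<times> {1..K}) \<subseteq> {..2 * K\<^sup>2}"
      proof (clarsimp)
        fix m n assume "m \<le> K" "n \<le> K"
        then have "m\<^sup>2 \<le> K\<^sup>2" "n\<^sup>2 \<le> K\<^sup>2" by (simp_all add: power_mono)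
        then show "m\<^sup>2 + n\<^sup>2 \<le> 2 * K\<^sup>2" by linarith
      qed
    qed auto
    also have "\<dots> = (\<Sum>k\<le>2 * K\<^sup>2. complex_of_real (\<Sum>(m,n)\<in>{(m,n)\<in>{1..K} \<times> {1..K}. m\<^sup>2 + n\<^sup>2 = k}. t m * t n)
         * fourier_char (int k) (x + s))"
      unfolding of_real_sum sum_distrib_right
      by (intro sum.cong refl) auto
    finally have "(sq_trig_sum t s K x)\<^sup>2 = \<dots>" .
    then have "(norm ((sq_trig_sum t s K x)\<^sup>2))\<^sup>2 = (norm (\<Sum>k\<le>2 * K\<^sup>2. complex_of_real (\<Sum>(m,n)\<in>{(m,n)\<in>{1..K} \<times> {1..K}. m\<^sup>2 + n\<^sup>2 = k}. t m * t n)
         * fourier_char (int k) (x + s)))\<^sup>2" by simp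
    then show ?thesis by (simp add: norm_power flip: power_mult)
  qed
  then show ?thesis
    by (simp only: parseval_trig_sum[OF finite_atMost inj_on_of_nat])
qed

lemma sq_trig_summable:
  assumes "summable (\<lambda>n. \<bar>t (Suc n)\<bar>)"
  shows "summable (\<lambda>n. of_real (t (Suc n)) * fourier_char (int (Suc n) ^ 2) (x + s) :: complex)"
  by (rule summable_norm_cancel) (simp add: norm_mult assms)

lemma sq_trig_sum_conv: "sq_trig_sum t s K x = (\<Sum>n<K. of_real (t (Suc n)) * fourier_char (int (Suc n) ^ 2) (x + s))"
  unfolding sq_trig_sum_def
  by (rule sum.reindex_bij_witness[where i = Suc and j = "\<lambda>m. m - 1"]) auto

text \<open>Dominated convergence: all partial sums are bounded by the sum of the absolute
  coefficients. The function \<open>h\<close> may depend on \<open>x\<close> so that powers of the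
  norm and products with a character are covered alike.\<close>

lemma tendsto_circle_integral_sq_trig_comp:
  fixes h :: "real \<Rightarrow> complex \<Rightarrow> 'a::{banach,second_countable_topology}"
  assumes summable: "summable (\<lambda>n. \<bar>t (Suc n)\<bar>)"
    and cont: "\<And>g. continuous_on UNIV g \<Longrightarrow> continuous_on UNIV (\<lambda>x. h x (g x))"
    and isCont: "\<And>x z. isCont (h x) z"
    and bound: "\<And>x z. norm z \<le> (\<Sum>n. \<bar>t (Suc n)\<bar>) \<Longrightarrow> norm (h x z) \<le> B"
  shows "(\<lambda>K. circle_integral (\<lambda>x. h x (sq_trig_sum t s K x)))
           \<longlonglongrightarrow> circle_integral (\<lambda>x. h x (sq_trig_series t s x))"
proof -
  have "(\<lambda>K. sq_trig_sum t s K x) \<longlonglongrightarrow> sq_trig_series t s x" for x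
    unfolding sq_trig_sum_conv sq_trig_series_def
    using summable_LIMSEQ[OF sq_trig_summable[OF summable]] .
  then have lim: "(\<lambda>K. h x (sq_trig_sum t s K x)) \<longlonglongrightarrow> h x (sq_trig_series t s x)" for x
    by (rule isCont_tendsto_compose[OF isCont])
  have bd: "norm (h x (sq_trig_sum t s K x)) \<le> B" for K x
  proof (rule bound)
    have "norm (sq_trig_sum t s K x) \<le> (\<Sum>n<K. \<bar>t (Suc n)\<bar>)"
      unfolding sq_trig_sum_conv by (rule order.trans[OF norm_sum]) (simp add: norm_mult)
    also have "\<dots> \<le> (\<Sum>n. \<bar>t (Suc n)\<bar>)" using summable by (intro sum_le_suminf) auto
    finally show "norm (sq_trig_sum t s K x) \<le> (\<Sum>n. \<bar>t (Suc n)\<bar>)" .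
  qed
  have meas: "(\<lambda>x. h x (sq_trig_sum t s K x)) \<in> borel_measurable borel" for K
    by (intro borel_measurable_continuous_onI cont continuous_on_sq_trig_sum)
  have meas': "(\<lambda>x. h x (sq_trig_series t s x)) \<in> borel_measurable borel"
    using lim meas by (rule borel_measurable_LIMSEQ_metric[rotated])
  show ?thesis
    unfolding circle_integral_def set_lebesgue_integral_def
  proof (rule integral_dominated_convergence[where w = "\<lambda>x. indicator {0..1} x *\<^sub>R B"])
    show "integrable lborel (\<lambda>x. indicator {0..1::real} x *\<^sub>R B)"
      by (intro integrable_indicator_continuous) auto
    show "AE x in lborel. (\<lambda>K. indicator {0..1} x *\<^sub>R h x (sq_trig_sum t s K x)) \<longlonglongrightarrow>
       indicator {0..1} x *\<^sub>R h x (sq_trig_series t s x)"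
      by (intro AE_I2 tendsto_intros lim)
    show "AE x in lborel. norm (indicator {0..1} x *\<^sub>R h x (sq_trig_sum t s K x)) \<le> indicator {0..1} x *\<^sub>R B" for K
      by (intro AE_I2) (auto simp: indicator_def bd)
  qed (use meas meas' in measurable)
qed

lemma tendsto_circle_integral_sq_trig:
  assumes "summable (\<lambda>n. \<bar>t (Suc n)\<bar>)"
  shows "(\<lambda>K. circle_integral (\<lambda>x. norm (sq_trig_sum t s K x) ^ j))
           \<longlonglongrightarrow> circle_integral (\<lambda>x. norm (sq_trig_series t s x) ^ j)"
  by (rule tendsto_circle_integral_sq_trig_comp[OF assms, where h = "\<lambda>x z. norm z ^ j" and B = "(\<Sum>n. \<bar>t (Suc n)\<bar>) ^ j"])
    (auto intro!: continuous_intros power_mono)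

section \<open>Fourier coefficients and the high-pass filter\<close>

lemma fourier_coeff_sq_trig_series:
  assumes "summable (\<lambda>n. \<bar>t (Suc n)\<bar>)"
  shows "fourier_coeff (sq_trig_series t 0) k = of_real (\<Sum>m\<in>{m. 1 \<le> m \<and> int m ^ 2 = k}. t m)"
proof -
  \<comment> \<open>Since \<open>m \<le> m\<^sup>2\<close>, every \<open>m\<close> with square
    \<open>k\<close> already occurs in the partial sum; the integrals are eventually constant in
    \<open>K\<close>. The sum on the right has at most one term.\<close>
  have "circle_integral (\<lambda>x. sq_trig_sum t 0 K x * fourier_char (- k) x) = of_real (\<Sum>m\<in>{m. 1 \<le> m \<and> int m ^ 2 = k}. t m)"
    if K: "K \<ge> nat k" for K
  proof -
    have "circle_integral (\<lambda>x. sq_trig_sum t 0 K x * fourier_char (- k) x)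
       = circle_integral (\<lambda>x. \<Sum>m=1..K. of_real (t m) * fourier_char (int m ^ 2 - k) (x + 0))"
      by (rule arg_cong[where f = circle_integral], rule ext)
        (simp add: sq_trig_sum_def sum_distrib_right mult.assoc flip: fourier_char_add)
    also have "\<dots> = (\<Sum>m=1..K. of_real (t m) * (if int m ^ 2 - k = 0 then 1 else 0))"
      by (simp only: circle_integral_sum circle_integral_mult_right circle_integral_fourier_char_shift
          continuous_intros)
    also have "\<dots> = (\<Sum>m\<in>{m\<in>{1..K}. int m ^ 2 = k}. of_real (t m))"
      by (subst sum.inter_filter) (auto intro!: sum.cong)
    also have "{m\<in>{1..K}. int m ^ 2 = k} = {m. 1 \<le> m \<and> int m ^ 2 = k}"
    proof -
      have "m \<le> K" if "int m ^ 2 = k" for m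
      proof -
        have "m \<le> m ^ 2" by (simp add: power2_eq_square)
        also have "m ^ 2 = nat k" using that by (metis nat_int of_nat_power)
        finally show ?thesis using K by linarith
      qed
      then show ?thesis by auto
    qed
    finally show ?thesis by simp
  qed
  then have "eventually (\<lambda>K. circle_integral (\<lambda>x. sq_trig_sum t 0 K x * fourier_char (- k) x)
      = of_real (\<Sum>m\<in>{m. 1 \<le> m \<and> int m ^ 2 = k}. t m)) sequentially"
    unfolding eventually_sequentially by blast
  then have "(\<lambda>K. circle_integral (\<lambda>x. sq_trig_sum t 0 K x * fourier_char (- k) x))
      \<longlonglongrightarrow> of_real (\<Sum>m\<in>{m. 1 \<le> m \<and> int m ^ 2 = k}. t m)"
    by (rule tendsto_eventually)
  moreover have "(\<lambda>K. circle_integral (\<lambda>x. sq_trig_sum t 0 K x * fourier_char (- k) x))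
      \<longlonglongrightarrow> fourier_coeff (sq_trig_series t 0) k"
    unfolding fourier_coeff_def
    by (rule tendsto_circle_integral_sq_trig_comp[OF assms, where h = "\<lambda>x z. z * fourier_char (- k) x" and B = "\<Sum>n. \<bar>t (Suc n)\<bar>"])
      (auto intro!: continuous_intros simp: norm_mult)
  ultimately show ?thesis by (rule LIMSEQ_unique[symmetric])
qed

text \<open>Only positive square frequencies have nonzero coefficients, so the unordered sum over
  the integers is reindexed along the injection \<open>n \<mapsto> (Suc n)\<^sup>2\<close>; absolute
  convergence identifies it with the ordered series.\<close>

lemma high_pass_sq_trig_series:
  assumes t: "summable (\<lambda>n. \<bar>t (Suc n)\<bar>)"
  shows "high_pass (sq_trig_series t 0) N = sq_trig_series (\<lambda>m. if N \<le> m\<^sup>2 then t m else 0) 0"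
proof
  fix x
  define t' where "t' = (\<lambda>m. if N \<le> m\<^sup>2 then t m else 0)"
  define F where "F = (\<lambda>k. fourier_coeff (sq_trig_series t 0) k * fourier_char k x)"
  define sq where "sq = (\<lambda>n. int (Suc n) ^ 2)"
  have inj: "inj sq" by (auto simp: inj_def sq_def power2_eq_iff_nonneg)
  have F_sq: "F (sq n) = of_real (t (Suc n)) * fourier_char (sq n) x" for n
  proof -
    have "{m. 1 \<le> m \<and> int m ^ 2 = sq n} = {Suc n}"
      by (auto simp: sq_def power2_eq_iff_nonneg)
    then show ?thesis by (simp add: F_def fourier_coeff_sq_trig_series[OF t])
  qed
  have F_0: "F k = 0" if "k \<notin> range sq" for k
  proof -
    have "{m. 1 \<le> m \<and> int m ^ 2 = k} = {}"
    proof (rule ccontr)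
      assume "{m. 1 \<le> m \<and> int m ^ 2 = k} \<noteq> {}"
      then obtain m where m: "1 \<le> m" "int m ^ 2 = k" by auto
      then have "k = sq (m - 1)" by (simp add: sq_def)
      then show False using that by blast
    qed
    then show ?thesis by (simp only: F_def fourier_coeff_sq_trig_series[OF t] sum.empty of_real_0 mult_zero_left)
  qed
  have t': "summable (\<lambda>n. \<bar>t' (Suc n)\<bar>)"
    by (rule summable_comparison_test'[OF t, of 0]) (simp add: t'_def)
  have "((\<lambda>n. of_real (t' (Suc n)) * fourier_char (sq n) x) has_sum sq_trig_series t' 0 x) UNIV"
  proof (rule norm_summable_imp_has_sum)
    show "summable (\<lambda>n. norm (of_real (t' (Suc n)) * fourier_char (sq n) x))"
      using t' by (simp add: norm_mult)
    show "(\<lambda>n. of_real (t' (Suc n)) * fourier_char (sq n) x) sums sq_trig_series t' 0 x"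
      using summable_sums[OF sq_trig_summable[OF t', of 0 x]] by (simp add: sq_trig_series_def sq_def)
  qed
  moreover have "(\<lambda>k. if \<bar>k\<bar> \<ge> int N then F k else 0) \<circ> sq = (\<lambda>n. of_real (t' (Suc n)) * fourier_char (sq n) x)"
  proof
    fix n
    have "\<bar>sq n\<bar> = int ((Suc n)\<^sup>2)" by (simp add: sq_def)
    then have "int N \<le> \<bar>sq n\<bar> \<longleftrightarrow> N \<le> (Suc n)\<^sup>2" by (simp only: of_nat_le_iff)
    then show "((\<lambda>k. if \<bar>k\<bar> \<ge> int N then F k else 0) \<circ> sq) n = of_real (t' (Suc n)) * fourier_char (sq n) x"
      by (simp add: F_sq t'_def)
  qed
  ultimately have "((\<lambda>k. if \<bar>k\<bar> \<ge> int N then F k else 0) has_sum sq_trig_series t' 0 x) (range sq)"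
    by (simp add: has_sum_reindex[OF inj])
  then have "(F has_sum sq_trig_series t' 0 x) {n. \<bar>n\<bar> \<ge> int N}"
    by (subst has_sum_cong_neutral[where f = F and g = "\<lambda>k. if \<bar>k\<bar> \<ge> int N then F k else 0" and T = "range sq"])
      (auto simp: F_0)
  then show "high_pass (sq_trig_series t 0) N x = sq_trig_series (\<lambda>m. if N \<le> m\<^sup>2 then t m else 0) 0 x"
    unfolding high_pass_def F_def t'_def by (rule infsumI)
qed

section \<open>Riemann's function and its increments\<close>

lemma riemann_fun_sq_trig_series: "riemann_fun = sq_trig_series (\<lambda>m. 1 / (real m)\<^sup>2) 0"
  by (rule ext) (simp add: riemann_fun_def sq_trig_series_def divide_inverse mult.commute)

lemma summable_inverse_squares_Suc: "summable (\<lambda>n. \<bar>1 / (real (Suc n))\<^sup>2\<bar>)"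
  using inverse_squares_sums by (auto simp: sums_iff add.commute)

text \<open>Centring at \<open>x + l / 2\<close> turns the difference of two characters of frequency
  \<open>k\<close> into \<open>2 * \<i> * sin (pi * k * l)\<close> times a character. The remaining
  weights are real, as the moment estimates require.\<close>

lemma riemann_fun_diff:
  "riemann_fun (x + l) - riemann_fun x
     = \<i> * sq_trig_series (\<lambda>m. 2 * sin (pi * (real m)\<^sup>2 * l) / (real m)\<^sup>2) (l / 2) x"
proof -
  define a where "a = (\<lambda>n y. of_real (1 / (real (Suc n))\<^sup>2) * fourier_char (int (Suc n) ^ 2) y)"
  have sm: "summable (\<lambda>n. a n y)" for y
    using sq_trig_summable[OF summable_inverse_squares_Suc, of 0 y] by (simp add: a_def)
  have R: "riemann_fun y = (\<Sum>n. a n y)" for y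
    by (simp add: riemann_fun_sq_trig_series sq_trig_series_def a_def)
  define b where "b = (\<lambda>n. complex_of_real (2 * sin (pi * (real (Suc n))\<^sup>2 * l) / (real (Suc n))\<^sup>2)
      * fourier_char (int (Suc n) ^ 2) (x + l / 2))"
  have eq: "a n (x + l) - a n x = \<i> * b n" for n
  proof -
    define k where "k = int (Suc n) ^ 2"
    have "fourier_char k (x + l) - fourier_char k x = fourier_char k (x + l / 2) * (fourier_char k (l / 2) - fourier_char k (- l / 2))"
      using fourier_char_add_right[of k "x + l / 2" "l / 2"] fourier_char_add_right[of k "x + l / 2" "- l / 2"]
      by (simp add: right_diff_distrib add.commute)
    also have "fourier_char k (l / 2) - fourier_char k (- l / 2) = 2 * \<i> * of_real (sin (pi * of_int k * l))"
      by (simp add: fourier_char_cis complex_eq_iff mult.assoc)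
    finally have *: "fourier_char k (x + l) - fourier_char k x
        = fourier_char k (x + l / 2) * (2 * \<i> * of_real (sin (pi * of_int k * l)))" .
    have "a n (x + l) - a n x = of_real (1 / (real (Suc n))\<^sup>2) * (fourier_char k (x + l) - fourier_char k x)"
      by (simp add: a_def k_def right_diff_distrib)
    also have "\<dots> = \<i> * b n"
      unfolding * by (simp add: b_def k_def)
    finally show ?thesis .
  qed
  have "summable (\<lambda>n. \<i> * b n)"
    using summable_diff[OF sm[of "x + l"] sm[of x]] by (simp add: eq)
  then have "summable b" by (simp add: summable_mult_D[of "\<i>"])
  have "riemann_fun (x + l) - riemann_fun x = (\<Sum>n. a n (x + l) - a n x)"
    by (simp add: R suminf_diff sm)
  also have "\<dots> = \<i> * (\<Sum>n. b n)"
    unfolding eq using \<open>summable b\<close> by (rule suminf_mult)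
  finally show ?thesis by (simp add: sq_trig_series_def b_def)
qed

section \<open>Second and fourth moments\<close>

text \<open>Sums of two squares bounded by \<open>2(42M)\<^sup>2\<close> only involve integers up to \<open>60M\<close>, so dropping the larger
  values of \<open>k\<close> from \<open>\<Sum>\<^sub>k (\<Sum> t\<^sub>m t\<^sub>n)\<^sup>2\<close> removes every term of uncertain sign.\<close>

locale sq_weights =
  fixes t :: "nat \<Rightarrow> real" and M :: nat and \<tau> C :: real
  assumes M_pos: "M > 0" and tau_nonneg: "\<tau> \<ge> 0"
    and upper: "\<And>m. m \<ge> 1 \<Longrightarrow> \<bar>t m\<bar> \<le> C / (real M + real m)\<^sup>2"
    and nonneg: "\<And>m. 1 \<le> m \<Longrightarrow> m \<le> 60 * M \<Longrightarrow> 0 \<le> t m"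
    and lower: "\<And>m. M \<le> m \<Longrightarrow> m \<le> 42 * M \<Longrightarrow> \<tau> / (real M)\<^sup>2 \<le> t m"
begin

definition envelope :: "nat \<Rightarrow> real" where "envelope m = 1 / (real M + real m)\<^sup>2"

definition moment :: "real \<Rightarrow> nat \<Rightarrow> real" where
  "moment s j = circle_integral (\<lambda>x. norm (sq_trig_series t s x) ^ j)"

lemma abs_weight_le: "m \<ge> 1 \<Longrightarrow> \<bar>t m\<bar> \<le> C * envelope m"
  using upper by (simp add: envelope_def)

lemma envelope_nonneg: "0 \<le> envelope m"
  by (simp add: envelope_def)

lemma envelope_le: "envelope m \<le> 1 / (real M)\<^sup>2"
  unfolding envelope_def using M_pos by (intro divide_left_mono power_mono) auto

lemma sum_envelope_le: "sum envelope {1..K} \<le> 1 / real M"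
proof -
  have "sum envelope {1..K} \<le> 2 / (1 * (2 * real M + 1))"
    using sum_inverse_square_shift_le[of "real M" 1 K] M_pos by (simp add: envelope_def)
  also have "\<dots> \<le> 1 / real M" using M_pos by (simp add: divide_simps)
  finally show ?thesis .
qed

lemma C_nonneg: "0 \<le> C"
proof -
  have "0 \<le> C / (real M + real 1)\<^sup>2" using upper[of 1] by (intro order.trans[OF abs_ge_zero]) auto
  then show ?thesis using M_pos by (simp add: zero_le_divide_iff)
qed

lemma summable_weights: "summable (\<lambda>n. \<bar>t (Suc n)\<bar>)"
proof -
  have "summable (\<lambda>n. envelope (Suc n))"
  proof (rule summableI_nonneg_bounded)
    show "(\<Sum>i<n. envelope (Suc i)) \<le> 1 / real M" for n
    proof -
      have "(\<Sum>i<n. envelope (Suc i)) = sum envelope {1..n}"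
        by (rule sum.reindex_bij_witness[where j = Suc and i = "\<lambda>m. m - 1"]) auto
      then show ?thesis using sum_envelope_le by simp
    qed
  qed (rule envelope_nonneg)
  then have "summable (\<lambda>n. C * envelope (Suc n))" by (rule summable_mult)
  then show ?thesis
    by (rule summable_comparison_test'[where N = 0]) (use abs_weight_le in simp)
qed

lemma tendsto_moment: "(\<lambda>K. circle_integral (\<lambda>x. norm (sq_trig_sum t s K x) ^ j)) \<longlonglongrightarrow> moment s j"
  unfolding moment_def by (intro tendsto_circle_integral_sq_trig summable_weights)

text \<open>For each partial sum the moment is a sum over solutions, which is bounded termwise by
  absolute values and then by the envelope. The bound is uniform in \<open>K\<close> and survives
  the limit.\<close>

lemma moment4_le: "moment s 4 \<le> C ^ 4 * (1 + 8 * harm (4 * M)) / real M ^ 6"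
proof (rule LIMSEQ_le_const2[OF tendsto_moment[of s 4]], intro exI allI impI)
  fix K :: nat
  have "circle_integral (\<lambda>x. norm (sq_trig_sum t s K x) ^ 4) =
      (\<Sum>((m,n),(p,q))\<in>sq_quads {1..K}. t m * t n * (t p * t q))"
    unfolding circle_integral_sq_trig_sum_power4
  proof (rule sum_sq_quads)
    fix m n assume "m \<in> {1..K}" "n \<in> {1..K}"
    then have "m\<^sup>2 \<le> K\<^sup>2" "n\<^sup>2 \<le> K\<^sup>2" by (simp_all add: power_mono)
    then show "m\<^sup>2 + n\<^sup>2 \<in> {..2 * K\<^sup>2}" unfolding atMost_iff by linarith
  qed auto
  also have "\<dots> \<le> (\<Sum>((m,n),(p,q))\<in>sq_quads {1..K}. C ^ 4 * (envelope m * envelope n * (envelope p * envelope q)))"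
  proof (rule sum_mono)
    fix x assume "x \<in> sq_quads {1..K}"
    then obtain m n p q where x: "x = ((m,n),(p,q))" "m \<ge> 1" "n \<ge> 1" "p \<ge> 1" "q \<ge> 1"
      by (auto simp: sq_quads_def)
    have "t m * t n * (t p * t q) \<le> \<bar>t m\<bar> * \<bar>t n\<bar> * (\<bar>t p\<bar> * \<bar>t q\<bar>)"
      by (simp flip: abs_mult)
    also have "\<dots> \<le> (C * envelope m) * (C * envelope n) * ((C * envelope p) * (C * envelope q))"
      using x by (intro mult_mono abs_weight_le mult_nonneg_nonneg envelope_nonneg C_nonneg) auto
    also have "\<dots> = C ^ 4 * (envelope m * envelope n * (envelope p * envelope q))" by (simp add: power4_eq_xxxx)
    finally show "(\<lambda>((m,n),(p,q)). t m * t n * (t p * t q)) x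
        \<le> (\<lambda>((m,n),(p,q)). C ^ 4 * (envelope m * envelope n * (envelope p * envelope q))) x" by (simp add: x)
  qed
  also have "\<dots> = C ^ 4 * (\<Sum>((m,n),(p,q))\<in>sq_quads {1..K}. envelope m * envelope n * (envelope p * envelope q))"
    by (simp add: sum_distrib_left case_prod_unfold)
  also have "\<dots> \<le> C ^ 4 * ((1 + 8 * harm (4 * M)) / real M ^ 6)"
    unfolding envelope_def using C_nonneg by (intro mult_left_mono sum_sq_quads_upper M_pos) auto
  finally show "circle_integral (\<lambda>x. norm (sq_trig_sum t s K x) ^ 4) \<le> C ^ 4 * (1 + 8 * harm (4 * M)) / real M ^ 6"
    by simp
qed

text \<open>Once large \<open>k\<close> are dropped, all products \<open>t m * t n\<close> are
  nonnegative, so restricting \<open>m\<close> and \<open>n\<close> to the window \<open>W\<close>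
  and replacing weights by their lower bound decreases each inner sum and hence its square. What
  remains is a multiple of the number of solutions in \<open>W\<close>.\<close>

lemma moment4_ge: "3 / 20 * \<tau> ^ 4 * harm M / real M ^ 6 \<le> moment s 4"
proof (rule LIMSEQ_le_const[OF tendsto_moment[of s 4]], intro exI allI impI)
  fix K :: nat assume K: "60 * M \<le> K"
  define W where "W = {M..42 * M}"
  have WK: "W \<subseteq> {1..K}" using M_pos K by (auto simp: W_def)
  have "3 / 20 * \<tau> ^ 4 * harm M / real M ^ 6 = (\<tau> / (real M)\<^sup>2) ^ 4 * (3 / 20 * (real M)\<^sup>2 * harm M)"
    using M_pos by (simp add: power_divide power_mult[symmetric] field_simps power_numeral_reduce)
  also have "\<dots> \<le> (\<tau> / (real M)\<^sup>2) ^ 4 * real (card (sq_quads W))"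
    unfolding W_def by (intro mult_left_mono card_sq_quads_ge M_pos) auto
  also have "\<dots> = (\<Sum>((m,n),(p,q))\<in>sq_quads W. \<tau> / (real M)\<^sup>2 * (\<tau> / (real M)\<^sup>2) * (\<tau> / (real M)\<^sup>2 * (\<tau> / (real M)\<^sup>2)))"
    by (simp add: power4_eq_xxxx power2_eq_square case_prod_unfold mult_ac)
  also have "\<dots> = (\<Sum>k\<le>2 * (42 * M)\<^sup>2. (\<Sum>(m,n)\<in>{(m,n)\<in>W \<times> W. m\<^sup>2 + n\<^sup>2 = k}. \<tau> / (real M)\<^sup>2 * (\<tau> / (real M)\<^sup>2))\<^sup>2)"
  proof (rule sum_sq_quads[symmetric])
    fix m n assume "m \<in> W" "n \<in> W"
    then have "m \<le> 42 * M" "n \<le> 42 * M" by (simp_all add: W_def)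
    then have "m\<^sup>2 \<le> (42 * M)\<^sup>2" "n\<^sup>2 \<le> (42 * M)\<^sup>2" by (simp_all only: power_mono zero_le)
    then show "m\<^sup>2 + n\<^sup>2 \<in> {..2 * (42 * M)\<^sup>2}" unfolding atMost_iff by linarith
  qed (auto simp: W_def)
  also have "\<dots> \<le> (\<Sum>k\<le>2 * (42 * M)\<^sup>2. (\<Sum>(m,n)\<in>{(m,n)\<in>{1..K} \<times> {1..K}. m\<^sup>2 + n\<^sup>2 = k}. t m * t n)\<^sup>2)"
  proof (rule sum_mono)
    fix k assume k: "k \<in> {..2 * (42 * M)\<^sup>2}"
    have small: "m \<le> 60 * M" if "m\<^sup>2 + n\<^sup>2 = k" for m n :: nat
    proof -
      have "m\<^sup>2 \<le> 2 * (42 * M)\<^sup>2" using k that unfolding atMost_iff by linarith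
      \<comment> \<open>This is where 60 comes from: 2 * 42 * 42 = 3528 \<le> 3600.\<close>
      also have "\<dots> \<le> (60 * M)\<^sup>2" by (simp add: power_mult_distrib)
      finally show ?thesis by (simp only: power2_nat_le_eq_le)
    qed
    have nn: "0 \<le> t m * t n" if "(m,n) \<in> {1..K} \<times> {1..K}" "m\<^sup>2 + n\<^sup>2 = k" for m n
      using that small[of m n] small[of n m] by (intro mult_nonneg_nonneg nonneg) (auto simp: add.commute)
    have "(\<Sum>(m,n)\<in>{(m,n)\<in>W \<times> W. m\<^sup>2 + n\<^sup>2 = k}. \<tau> / (real M)\<^sup>2 * (\<tau> / (real M)\<^sup>2))
       \<le> (\<Sum>(m,n)\<in>{(m,n)\<in>W \<times> W. m\<^sup>2 + n\<^sup>2 = k}. t m * t n)"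
    proof (intro sum_mono, clarify)
      fix m n assume "m \<in> W" "n \<in> W"
      then have "\<tau> / (real M)\<^sup>2 \<le> t m" "\<tau> / (real M)\<^sup>2 \<le> t n" by (auto simp: W_def intro!: lower)
      moreover have "0 \<le> \<tau> / (real M)\<^sup>2" using tau_nonneg by simp
      ultimately show "\<tau> / (real M)\<^sup>2 * (\<tau> / (real M)\<^sup>2) \<le> t m * t n"
        by (intro mult_mono) linarith+
    qed
    also have "\<dots> \<le> (\<Sum>(m,n)\<in>{(m,n)\<in>{1..K} \<times> {1..K}. m\<^sup>2 + n\<^sup>2 = k}. t m * t n)"
    proof (rule sum_mono2)
      show "finite {(m,n)\<in>{1..K} \<times> {1..K}. m\<^sup>2 + n\<^sup>2 = k}"
        by (rule finite_subset[of _ "{1..K} \<times> {1..K}"]) auto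
    qed (use WK nn in auto)
    finally show "(\<Sum>(m,n)\<in>{(m,n)\<in>W \<times> W. m\<^sup>2 + n\<^sup>2 = k}. \<tau> / (real M)\<^sup>2 * (\<tau> / (real M)\<^sup>2))\<^sup>2
       \<le> (\<Sum>(m,n)\<in>{(m,n)\<in>{1..K} \<times> {1..K}. m\<^sup>2 + n\<^sup>2 = k}. t m * t n)\<^sup>2"
      using tau_nonneg by (intro power_mono sum_nonneg) auto
  qed
  also have "\<dots> \<le> (\<Sum>k\<le>2 * K\<^sup>2. (\<Sum>(m,n)\<in>{(m,n)\<in>{1..K} \<times> {1..K}. m\<^sup>2 + n\<^sup>2 = k}. t m * t n)\<^sup>2)"
  proof (rule sum_mono2)
    have "(42 * M)\<^sup>2 \<le> K\<^sup>2" using K by (intro power_mono) auto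
    then show "{..2 * (42 * M)\<^sup>2} \<subseteq> {..2 * K\<^sup>2}" by auto
  qed auto
  also have "\<dots> = circle_integral (\<lambda>x. norm (sq_trig_sum t s K x) ^ 4)"
    by (rule circle_integral_sq_trig_sum_power4[symmetric])
  finally show "3 / 20 * \<tau> ^ 4 * harm M / real M ^ 6 \<le> circle_integral (\<lambda>x. norm (sq_trig_sum t s K x) ^ 4)" .
qed

lemma moment2_le: "moment s 2 \<le> C\<^sup>2 / real M ^ 3"
proof (rule LIMSEQ_le_const2[OF tendsto_moment[of s 2]], intro exI allI impI)
  fix K :: nat
  have "circle_integral (\<lambda>x. norm (sq_trig_sum t s K x) ^ 2) = (\<Sum>m=1..K. (t m)\<^sup>2)"
    by (rule circle_integral_sq_trig_sum_power2)
  also have "\<dots> \<le> (\<Sum>m=1..K. C\<^sup>2 * (1 / (real M)\<^sup>2 * envelope m))"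
  proof (rule sum_mono)
    fix m assume "m \<in> {1..K}"
    then have "\<bar>t m\<bar>\<^sup>2 \<le> (C * envelope m)\<^sup>2" by (intro power_mono abs_weight_le) auto
    also have "\<dots> = C\<^sup>2 * (envelope m * envelope m)" by (simp add: power2_eq_square)
    also have "\<dots> \<le> C\<^sup>2 * (1 / (real M)\<^sup>2 * envelope m)"
      by (intro mult_left_mono mult_right_mono envelope_le envelope_nonneg) auto
    finally show "(t m)\<^sup>2 \<le> C\<^sup>2 * (1 / (real M)\<^sup>2 * envelope m)" by simp
  qed
  also have "\<dots> = C\<^sup>2 * (1 / (real M)\<^sup>2 * sum envelope {1..K})" by (simp add: sum_distrib_left)
  also have "\<dots> \<le> C\<^sup>2 * (1 / (real M)\<^sup>2 * (1 / real M))"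
    by (intro mult_left_mono sum_envelope_le) auto
  also have "\<dots> = C\<^sup>2 / real M ^ 3" by (simp add: power_numeral_reduce)
  finally show "circle_integral (\<lambda>x. norm (sq_trig_sum t s K x) ^ 2) \<le> C\<^sup>2 / real M ^ 3" .
qed

lemma moment2_ge: "\<tau>\<^sup>2 / real M ^ 3 \<le> moment s 2"
proof (rule LIMSEQ_le_const[OF tendsto_moment[of s 2]], intro exI allI impI)
  fix K :: nat assume K: "60 * M \<le> K"
  have "\<tau>\<^sup>2 / real M ^ 3 = real M * (\<tau> / (real M)\<^sup>2)\<^sup>2"
    using M_pos by (simp add: power_divide field_simps power_numeral_reduce)
  \<comment> \<open>The interval has \<open>M + 1\<close> elements, all inside the window where the
    lower bound on \<open>t\<close> holds.\<close>
  also have "\<dots> \<le> real (card {M..2 * M}) * (\<tau> / (real M)\<^sup>2)\<^sup>2"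
    by (intro mult_right_mono) auto
  also have "\<dots> = (\<Sum>m\<in>{M..2 * M}. (\<tau> / (real M)\<^sup>2)\<^sup>2)" by simp
  also have "\<dots> \<le> (\<Sum>m\<in>{M..2 * M}. (t m)\<^sup>2)"
    using tau_nonneg by (intro sum_mono power_mono lower) auto
  also have "\<dots> \<le> (\<Sum>m=1..K. (t m)\<^sup>2)"
    using M_pos K by (intro sum_mono2) auto
  also have "\<dots> = circle_integral (\<lambda>x. norm (sq_trig_sum t s K x) ^ 2)"
    by (rule circle_integral_sq_trig_sum_power2[symmetric])
  finally show "\<tau>\<^sup>2 / real M ^ 3 \<le> circle_integral (\<lambda>x. norm (sq_trig_sum t s K x) ^ 2)" .
qed

section \<open>Moments in terms of a real scale \<open>y\<close> comparable to the square of
  \<open>M\<close>\<close>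

context
  fixes y :: real
  assumes y: "3 \<le> y" "y \<le> (real M)\<^sup>2" "(real M)\<^sup>2 \<le> 4 * y"
begin

text \<open>The threshold 3 exceeds Euler's number; this lets additive constants be absorbed into
  \<open>ln y\<close>.\<close>

lemma ln_y_ge_1: "1 \<le> ln y"
  using y exp_le by (subst ln_ge_iff) auto

lemma ln_M_bounds: "ln y \<le> 2 * ln (real M)" "2 * ln (real M) \<le> ln y + 2 * ln 2"
proof -
  have eq: "ln ((real M)\<^sup>2) = 2 * ln (real M)" using M_pos by (simp add: ln_realpow)
  have "ln y \<le> ln ((real M)\<^sup>2)" using y by (intro ln_mono) auto
  then show "ln y \<le> 2 * ln (real M)" by (simp add: eq)
  have "ln ((real M)\<^sup>2) \<le> ln (2\<^sup>2 * y)" using y M_pos by (intro ln_mono) auto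
  also have "\<dots> = ln y + 2 * ln 2" using y ln_realpow[of "2 :: real" 2] by (subst ln_mult) auto
  finally show "2 * ln (real M) \<le> ln y + 2 * ln 2" by (simp add: eq)
qed

lemma M_power_bounds:
  "y ^ 3 \<le> real M ^ 6" "real M ^ 6 \<le> 64 * y ^ 3"
  "y powr (3/2) \<le> real M ^ 3" "real M ^ 3 \<le> 8 * y powr (3/2)"
proof -
  have M6: "real M ^ 6 = ((real M)\<^sup>2) ^ 3" by (simp flip: power_mult)
  show "y ^ 3 \<le> real M ^ 6" unfolding M6 using y by (intro power_mono) auto
  have "((real M)\<^sup>2) ^ 3 \<le> (4 * y) ^ 3" using y by (intro power_mono) auto
  then show "real M ^ 6 \<le> 64 * y ^ 3" unfolding M6 by (simp add: power_mult_distrib)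
  have M3: "real M ^ 3 = ((real M)\<^sup>2) powr (3/2)"
    using M_pos by (simp add: powr_powr flip: powr_numeral)
  show "y powr (3/2) \<le> real M ^ 3" unfolding M3 using y by (intro powr_mono2) auto
  have "((real M)\<^sup>2) powr (3/2) \<le> (2\<^sup>2 * y) powr (3/2)" using y by (intro powr_mono2) auto
  also have "\<dots> = (2\<^sup>2) powr (3/2) * y powr (3/2)" using y by (subst powr_mult) auto
  also have "(2\<^sup>2 :: real) powr (3/2) = 2 powr 3" by (subst powr_numeral[symmetric]) (simp_all add: powr_powr del: powr_numeral)
  finally show "real M ^ 3 \<le> 8 * y powr (3/2)" unfolding M3 by simp
qed

text \<open>The lower constant is 3/20 * 1/2 * 1/64, from the solution count,
  \<open>harm M \<ge> ln y / 2\<close> and \<open>M ^ 6 \<le> 64 * y ^ 3\<close>. In the upper one,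
  37 = 9 + 24 + 4, using \<open>ln 2 < 1 \<le> ln y\<close>.\<close>

lemma moment4_comparable:
  "3 / 2560 * \<tau> ^ 4 * (y powr (-3) * ln y) \<le> moment s 4"
  "moment s 4 \<le> 37 * C ^ 4 * (y powr (-3) * ln y)"
proof -
  have y3: "y powr (-3) = 1 / y ^ 3" using y by (simp add: powr_minus_divide)
  have "3 / 2560 * \<tau> ^ 4 * (y powr (-3) * ln y) = (3 / 20 * \<tau> ^ 4 * (ln y / 2)) / (64 * y ^ 3)"
    by (simp add: y3)
  also have "\<dots> \<le> (3 / 20 * \<tau> ^ 4 * harm M) / (64 * y ^ 3)"
  proof (intro divide_right_mono mult_left_mono)
    have "ln (real M) \<le> ln (real M + 1)" using M_pos by (intro ln_mono) auto
    then show "ln y / 2 \<le> harm M" using ln_M_bounds(1) ln_le_harm[of M] by linarith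
  qed (use y in auto)
  also have "\<dots> \<le> (3 / 20 * \<tau> ^ 4 * harm M) / real M ^ 6"
    using M_pos y M_power_bounds by (intro divide_left_mono mult_nonneg_nonneg harm_nonneg) auto
  also have "\<dots> \<le> moment s 4" by (rule moment4_ge)
  finally show "3 / 2560 * \<tau> ^ 4 * (y powr (-3) * ln y) \<le> moment s 4" .
  have "harm (4 * M) \<le> ln (real (4 * M)) + 1"
  proof -
    \<comment> \<open>The sequence \<open>harm n - ln n\<close> decreases from its value 1 at
      \<open>n = 1\<close>.\<close>
    have "harm (Suc (4 * M - 1)) - ln (real (Suc (4 * M - 1))) \<le> harm (Suc 0) - ln (real (Suc 0))"
      using decseq_harm_diff_ln by (rule decseqD) simp
    then show ?thesis using M_pos by (simp add: harm_expand)
  qed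
  also have "ln (real (4 * M)) = 2 * ln 2 + ln (real M)"
    using M_pos ln_realpow[of "2 :: real" 2] by (simp add: ln_mult)
  finally have "1 + 8 * harm (4 * M) \<le> 9 + 24 * ln 2 + 4 * ln y"
    using ln_M_bounds(2) by (simp add: algebra_simps)
  also have "\<dots> \<le> 37 * ln y" using ln_y_ge_1 ln_2_less_1 by linarith
  finally have h: "1 + 8 * harm (4 * M) \<le> 37 * ln y" .
  have "moment s 4 \<le> C ^ 4 * (1 + 8 * harm (4 * M)) / real M ^ 6" by (rule moment4_le)
  also have "\<dots> \<le> C ^ 4 * (37 * ln y) / y ^ 3"
    using y C_nonneg ln_y_ge_1 M_power_bounds h by (intro frac_le mult_nonneg_nonneg mult_left_mono) auto
  also have "\<dots> = 37 * C ^ 4 * (y powr (-3) * ln y)" by (simp add: y3)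
  finally show "moment s 4 \<le> 37 * C ^ 4 * (y powr (-3) * ln y)" .
qed

lemma moment2_comparable:
  "\<tau>\<^sup>2 / 8 * y powr (-3/2) \<le> moment s 2"
  "moment s 2 \<le> C\<^sup>2 * y powr (-3/2)"
proof -
  have y3: "y powr (-3/2) = 1 / y powr (3/2)" using powr_minus_divide[of y "3/2"] by simp
  have "\<tau>\<^sup>2 / 8 * y powr (-3/2) = \<tau>\<^sup>2 / (8 * y powr (3/2))" unfolding y3 by simp
  also have "\<dots> \<le> \<tau>\<^sup>2 / real M ^ 3"
    using M_pos y M_power_bounds by (intro divide_left_mono) auto
  also have "\<dots> \<le> moment s 2" by (rule moment2_ge)
  finally show "\<tau>\<^sup>2 / 8 * y powr (-3/2) \<le> moment s 2" .
  have "moment s 2 \<le> C\<^sup>2 / real M ^ 3" by (rule moment2_le)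
  also have "\<dots> \<le> C\<^sup>2 / y powr (3/2)"
    using M_pos y M_power_bounds by (intro divide_left_mono) auto
  finally show "moment s 2 \<le> C\<^sup>2 * y powr (-3/2)" unfolding y3 by simp
qed

end

end

section \<open>The Riemann function\<close>

lemma Lp_norm_power:
  "Lp_norm (numeral k) f ^ numeral k = circle_integral (\<lambda>x. norm (f x) ^ numeral k)"
proof -
  have "0 \<le> circle_integral (\<lambda>x. norm (f x) ^ numeral k)"
    unfolding circle_integral_def set_lebesgue_integral_def by (intro integral_nonneg_AE) auto
  then show ?thesis
    by (simp add: Lp_norm_def powr_powr flip: powr_numeral[of "_ powr _"])
qed

text \<open>Taylor's bound gives \<open>sin x \<ge> x - x ^ 3 / 6\<close>, and
  \<open>x ^ 3 \<le> x\<close> on the unit interval.\<close>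

lemma sin_ge_half:
  assumes "0 \<le> x" "x \<le> 1"
  shows "x / 2 \<le> sin (x :: real)"
proof -
  have "\<bar>sin x - x\<bar> \<le> x ^ 3 / 6"
    using assms Maclaurin_sin_bound[of x 3] by (simp add: numeral_3_eq_3 sin_coeff_def fact_numeral)
  moreover have "x ^ 3 \<le> x" using assms power_decreasing[of 1 3 x] by simp
  ultimately show ?thesis using assms(1) by linarith
qed

text \<open>Positivity of \<open>A\<close> follows from the lower bound, and \<open>max c C\<close>
  provides the required order of the constants.\<close>

lemma comparable_onI:
  assumes "0 < c" "\<And>t. t \<in> S \<Longrightarrow> 0 < B t"
    "\<And>t. t \<in> S \<Longrightarrow> c * B t \<le> A t" "\<And>t. t \<in> S \<Longrightarrow> A t \<le> C * B t"
  shows "comparable_on S A B"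
  unfolding comparable_on_def
proof (intro conjI exI ballI)
  show "c \<le> max c C" by simp
  fix t assume t: "t \<in> S"
  show "0 < A t" using assms(1) assms(2,3)[OF t] by (smt (verit) mult_pos_pos)
  show "A t \<le> max c C * B t"
    using assms(4)[OF t] assms(2)[OF t] by (smt (verit) mult_right_mono)
qed (use assms in auto)

lemma comparable_on_flatness:
  assumes AB: "comparable_on S A B" and CD: "comparable_on S C D"
    and E: "\<And>t. t \<in> S \<Longrightarrow> B t = E t * (D t)\<^sup>2"
  shows "comparable_on S (\<lambda>t. A t / (C t)\<^sup>2) E"
proof -
  obtain a a' where a: "0 < a" "\<And>t. t \<in> S \<Longrightarrow> a * B t \<le> A t" "\<And>t. t \<in> S \<Longrightarrow> A t \<le> a' * B t"
    and pos: "\<And>t. t \<in> S \<Longrightarrow> 0 < A t" "\<And>t. t \<in> S \<Longrightarrow> 0 < B t"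
    using AB unfolding comparable_on_def by blast
  obtain c c' where c: "0 < c" "c \<le> c'" "\<And>t. t \<in> S \<Longrightarrow> c * D t \<le> C t" "\<And>t. t \<in> S \<Longrightarrow> C t \<le> c' * D t"
    and pos': "\<And>t. t \<in> S \<Longrightarrow> 0 < C t" "\<And>t. t \<in> S \<Longrightarrow> 0 < D t"
    using CD unfolding comparable_on_def by blast
  show ?thesis
  proof (rule comparable_onI)
    show "0 < a / c'\<^sup>2" using a c by auto
    fix t assume t: "t \<in> S"
    show E0: "0 < E t" using pos(2)[OF t] pos'(2)[OF t] E[OF t] by (simp add: zero_less_mult_iff)
    have "a / c'\<^sup>2 * E t = a * B t / (c' * D t)\<^sup>2"
      using E[OF t] pos'[OF t] by (simp add: power_mult_distrib)
    also have "\<dots> \<le> A t / (C t)\<^sup>2"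
      using a(2)[OF t] c(4)[OF t] pos[OF t] pos'[OF t] by (intro frac_le power_mono) auto
    finally show "a / c'\<^sup>2 * E t \<le> A t / (C t)\<^sup>2" .
    have "A t / (C t)\<^sup>2 \<le> a' * B t / (c * D t)\<^sup>2"
      using a(3)[OF t] c(1) c(3)[OF t] pos[OF t] pos'[OF t] by (intro frac_le power_mono) auto
    also have "\<dots> = a' / c\<^sup>2 * E t"
      using E[OF t] pos'[OF t] by (simp add: power_mult_distrib)
    finally show "A t / (C t)\<^sup>2 \<le> a' / c\<^sup>2 * E t" .
  qed
qed

lemma comparable_on_at_top:
  assumes "comparable_on S A B" "eventually (\<lambda>t. t \<in> S) F" "filterlim B at_top F"
  shows "filterlim A at_top F"
proof -
  obtain c where c: "0 < c" "\<And>t. t \<in> S \<Longrightarrow> c * B t \<le> A t"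
    using assms(1) unfolding comparable_on_def by blast
  have "filterlim (\<lambda>t. c * B t) at_top F"
    using c(1) assms(3) by (rule filterlim_tendsto_pos_mult_at_top[OF tendsto_const])
  then show ?thesis
    by (rule filterlim_at_top_mono) (use assms(2) c(2) in \<open>auto elim: eventually_mono\<close>)
qed

section \<open>Admissible weights for the filter and for increments\<close>

lemma high_pass_riemann_weights:
  assumes "N > 0"
  obtains M where "real N \<le> (real M)\<^sup>2" "(real M)\<^sup>2 \<le> 4 * real N"
    "sq_weights (\<lambda>m. if N \<le> m\<^sup>2 then 1 / (real m)\<^sup>2 else 0) M (1 / 1764) 4"
proof -
  \<comment> \<open>\<open>M\<close> is the square root of \<open>N\<close> rounded up, so the
    cut-off \<open>N \<le> m\<^sup>2\<close> becomes \<open>M \<le> m\<close>. There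
    \<open>M + m \<le> 2 * m\<close> yields the constant 4, and 1764 is the square of 42.\<close>
  define M where "M = (LEAST m. N \<le> m\<^sup>2)"
  have "N \<le> N\<^sup>2" by (simp add: power2_eq_square)
  then have M: "N \<le> M\<^sup>2" unfolding M_def by (rule LeastI)
  have M_iff: "N \<le> m\<^sup>2 \<longleftrightarrow> M \<le> m" for m
  proof
    show "N \<le> m\<^sup>2 \<Longrightarrow> M \<le> m" unfolding M_def by (rule Least_le)
    show "M \<le> m \<Longrightarrow> N \<le> m\<^sup>2" using M by (meson order.trans power_mono zero_le)
  qed
  have M0: "M > 0" using M assms by (auto intro!: Nat.gr0I)
  have M4: "M\<^sup>2 \<le> 4 * N"
  proof (cases "M = 1")
    case True
    then show ?thesis using assms by simp
  next
    case False
    then have "M \<le> 2 * (M - 1)" using M0 by simp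
    then have "M\<^sup>2 \<le> (2 * (M - 1))\<^sup>2" by (rule power_mono) simp
    also have "\<dots> = 4 * (M - 1)\<^sup>2" by (simp add: power_mult_distrib)
    also have "(M - 1)\<^sup>2 \<le> N" using M_iff[of "M - 1"] M0 by linarith
    finally show ?thesis by simp
  qed
  show thesis
  proof
    show "real N \<le> (real M)\<^sup>2" using M by (metis of_nat_le_iff of_nat_power)
    show "(real M)\<^sup>2 \<le> 4 * real N" using M4 by (metis of_nat_le_iff of_nat_power of_nat_mult of_nat_numeral)
    show "sq_weights (\<lambda>m. if N \<le> m\<^sup>2 then 1 / (real m)\<^sup>2 else 0) M (1 / 1764) 4"
    proof
      fix m :: nat assume "m \<ge> 1"
      have "1 / (real m)\<^sup>2 \<le> 4 / (real M + real m)\<^sup>2" if "M \<le> m"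
      proof -
        have "(real M + real m)\<^sup>2 \<le> (2 * real m)\<^sup>2" using that by (intro power_mono) auto
        then show ?thesis using \<open>m \<ge> 1\<close> M0 by (simp add: field_simps power_mult_distrib)
      qed
      then show "\<bar>if N \<le> m\<^sup>2 then 1 / (real m)\<^sup>2 else 0\<bar> \<le> 4 / (real M + real m)\<^sup>2"
        by (simp add: M_iff)
    next
      fix m assume m: "M \<le> m" "m \<le> 42 * M"
      then have "real m \<le> 42 * real M" by linarith
      then have "(real m)\<^sup>2 \<le> (42 * real M)\<^sup>2" by (rule power_mono) simp
      then have "1 / (42 * real M)\<^sup>2 \<le> 1 / (real m)\<^sup>2"
        using m M0 by (intro divide_left_mono) auto
      then show "1 / 1764 / (real M)\<^sup>2 \<le> (if N \<le> m\<^sup>2 then 1 / (real m)\<^sup>2 else 0)"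
        using m by (simp add: M_iff power_mult_distrib)
    qed (use M0 in auto)
  qed
qed

text \<open>The scale is chosen so that \<open>M\<^sup>2 * l \<le> 1/7200\<close>. Then
  \<open>pi * m\<^sup>2 * l\<close> is at most \<open>pi\<close> for \<open>m \<le> 60 * M\<close>,
  so the sine is nonnegative, and at most 1 for \<open>m \<le> 42 * M\<close>, so
  \<open>sin_ge_half\<close> gives weights of at least \<open>pi * l\<close>. The factor 28800 = 4 *
  7200 accounts for \<open>M\<^sup>2 \<le> 4 * y\<close>.\<close>

lemma structure_riemann_weights:
  assumes l: "0 < l" "28800 * l \<le> 1"
  obtains M where "1 / (28800 * l) \<le> (real M)\<^sup>2" "(real M)\<^sup>2 \<le> 4 * (1 / (28800 * l))"
    "sq_weights (\<lambda>m. 2 * sin (pi * (real m)\<^sup>2 * l) / (real m)\<^sup>2) M (1 / 28800) 8"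
proof -
  define y where "y = 1 / (28800 * l)"
  have y: "1 \<le> y" using l by (simp add: y_def field_simps)
  define M where "M = nat \<lfloor>sqrt (4 * y)\<rfloor>"
  have s: "2 \<le> sqrt (4 * y)" using y by (intro real_le_rsqrt) auto
  have M: "real M \<le> sqrt (4 * y)" "sqrt (4 * y) < real M + 1"
  proof -
    have "real M = of_int \<lfloor>sqrt (4 * y)\<rfloor>" using y by (simp add: M_def)
    then show "real M \<le> sqrt (4 * y)" "sqrt (4 * y) < real M + 1"
      using floor_correct[of "sqrt (4 * y)"] by simp_all
  qed
  have "0 < real M" using M s by linarith
  then have M0: "M > 0" by simp
  have "(real M)\<^sup>2 \<le> (sqrt (4 * y))\<^sup>2" using M by (intro power_mono) auto
  then have M4: "(real M)\<^sup>2 \<le> 4 * y" using y by simp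
  have "sqrt (4 * y) \<le> 2 * real M" using M M0 by linarith
  then have "(sqrt (4 * y))\<^sup>2 \<le> (2 * real M)\<^sup>2" by (rule power_mono) (use y in simp)
  then have My: "y \<le> (real M)\<^sup>2" using y by (simp add: power_mult_distrib)
  have Ml: "(real M)\<^sup>2 * l \<le> 1 / 7200" using M4 l by (simp add: y_def field_simps)
  have lM: "1 / 28800 / (real M)\<^sup>2 \<le> l" using My l M0 by (simp add: y_def field_simps)
  show thesis
  proof
    show "1 / (28800 * l) \<le> (real M)\<^sup>2" "(real M)\<^sup>2 \<le> 4 * (1 / (28800 * l))"
      using My M4 by (auto simp: y_def)
    show "sq_weights (\<lambda>m. 2 * sin (pi * (real m)\<^sup>2 * l) / (real m)\<^sup>2) M (1 / 28800) 8"
    proof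
      fix m :: nat assume m: "m \<ge> 1"
      show "\<bar>2 * sin (pi * (real m)\<^sup>2 * l) / (real m)\<^sup>2\<bar> \<le> 8 / (real M + real m)\<^sup>2"
      \<comment> \<open>Past \<open>M\<close> the sine is bounded by 1; below \<open>M\<close> it is
        bounded by its argument, which makes the weight at most \<open>2 * pi * l\<close>, of order
        at most \<open>1 / M\<^sup>2\<close>.\<close>
      proof (cases "M \<le> m")
        case True
        have "\<bar>2 * sin (pi * (real m)\<^sup>2 * l) / (real m)\<^sup>2\<bar> \<le> 2 / (real m)\<^sup>2"
          by (simp add: abs_mult divide_right_mono)
        also have "\<dots> = 8 / (2 * real m)\<^sup>2" by (simp add: power_mult_distrib)
        also have "\<dots> \<le> 8 / (real M + real m)\<^sup>2"
          using True m by (intro divide_left_mono power_mono) auto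
        finally show ?thesis .
      next
        case False
        have "\<bar>2 * sin (pi * (real m)\<^sup>2 * l) / (real m)\<^sup>2\<bar> \<le> 2 * \<bar>pi * (real m)\<^sup>2 * l\<bar> / (real m)\<^sup>2"
          unfolding abs_divide abs_mult[of 2] using m abs_sin_x_le_abs_x[of "pi * (real m)\<^sup>2 * l"]
          by (intro divide_mono) auto
        also have "\<dots> = 2 * pi * l" using m l by simp
        also have "\<dots> \<le> 2 * 4 * l" using l pi_less_4 by (intro mult_right_mono mult_left_mono) auto
        also have "\<dots> \<le> 8 / (2 * real M)\<^sup>2" using Ml M0 by (simp add: field_simps power_mult_distrib)
        also have "\<dots> \<le> 8 / (real M + real m)\<^sup>2"
          using False m by (intro divide_left_mono power_mono) auto
        finally show ?thesis .
      qed
    next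
      fix m assume m: "1 \<le> m" "m \<le> 60 * M"
      then have "real m \<le> 60 * real M" by linarith
      then have "(real m)\<^sup>2 \<le> (60 * real M)\<^sup>2" by (rule power_mono) simp
      then have "(real m)\<^sup>2 * l \<le> (60 * real M)\<^sup>2 * l" using l by (intro mult_right_mono) auto
      also have "\<dots> \<le> 1" using Ml by (simp add: power_mult_distrib)
      finally have "pi * ((real m)\<^sup>2 * l) \<le> pi * 1" by (intro mult_left_mono) auto
      then have "0 \<le> sin (pi * (real m)\<^sup>2 * l)" using l by (intro sin_ge_zero) (auto simp: mult.assoc)
      then show "0 \<le> 2 * sin (pi * (real m)\<^sup>2 * l) / (real m)\<^sup>2" by simp
    next
      fix m assume m: "M \<le> m" "m \<le> 42 * M"
      then have "real m \<le> 42 * real M" by linarith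
      then have "(real m)\<^sup>2 \<le> (42 * real M)\<^sup>2" by (rule power_mono) simp
      then have "(real m)\<^sup>2 * l \<le> (42 * real M)\<^sup>2 * l" using l by (intro mult_right_mono) auto
      also have "\<dots> \<le> 1 / 4" using Ml by (simp add: power_mult_distrib)
      finally have "pi * ((real m)\<^sup>2 * l) \<le> 4 * (1 / 4)"
        using pi_less_4 l by (intro mult_mono) auto
      then have "pi * (real m)\<^sup>2 * l / 2 \<le> sin (pi * (real m)\<^sup>2 * l)"
        using l by (intro sin_ge_half) (auto simp: mult.assoc)
      then have "pi * l \<le> 2 * sin (pi * (real m)\<^sup>2 * l) / (real m)\<^sup>2"
        using order.strict_trans2[OF M0 m(1)] by (simp add: field_simps)
      moreover have "l \<le> pi * l" using l pi_gt3 by simp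
      ultimately show "1 / 28800 / (real M)\<^sup>2 \<le> 2 * sin (pi * (real m)\<^sup>2 * l) / (real m)\<^sup>2"
        using lM by linarith
    qed (use M0 in auto)
  qed
qed

section \<open>Comparability of the moments and flatness\<close>

lemma riemann_high_pass_comparable:
  shows "comparable_on {2<..} (\<lambda>N. Lp_norm 4 (high_pass riemann_fun N) ^ 4) (\<lambda>N. real N powr (-3) * ln (real N))"
    and "comparable_on {2<..} (\<lambda>N. Lp_norm 2 (high_pass riemann_fun N) ^ 2) (\<lambda>N. real N powr (-3/2))"
proof -
  have "3 / 2560 * (1 / 1764) ^ 4 * (real N powr (-3) * ln (real N)) \<le> Lp_norm 4 (high_pass riemann_fun N) ^ 4 \<and>
      Lp_norm 4 (high_pass riemann_fun N) ^ 4 \<le> 37 * 4 ^ 4 * (real N powr (-3) * ln (real N)) \<and>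
      (1 / 1764)\<^sup>2 / 8 * real N powr (-3/2) \<le> Lp_norm 2 (high_pass riemann_fun N) ^ 2 \<and>
      Lp_norm 2 (high_pass riemann_fun N) ^ 2 \<le> 4\<^sup>2 * real N powr (-3/2)" if N: "2 < N" for N
  proof -
    obtain M where M: "real N \<le> (real M)\<^sup>2" "(real M)\<^sup>2 \<le> 4 * real N"
      and w: "sq_weights (\<lambda>m. if N \<le> m\<^sup>2 then 1 / (real m)\<^sup>2 else 0) M (1 / 1764) 4"
      using high_pass_riemann_weights[of N] N by auto
    interpret sq_weights "\<lambda>m. if N \<le> m\<^sup>2 then 1 / (real m)\<^sup>2 else 0" M "1 / 1764" 4 by (fact w)
    have I: "Lp_norm (numeral j) (high_pass riemann_fun N) ^ numeral j = moment 0 (numeral j)" for j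
      unfolding Lp_norm_power moment_def riemann_fun_sq_trig_series
      by (subst high_pass_sq_trig_series[OF summable_inverse_squares_Suc]) simp
    have N3: "3 \<le> real N" using N by simp
    show ?thesis unfolding I
      using moment4_comparable[OF N3 M, of 0] moment2_comparable[OF N3 M, of 0] by blast
  qed
  moreover have "0 < real N powr (-3) * ln (real N)" "0 < real N powr (-3/2)" if "2 < N" for N
    using that by auto
  ultimately show "comparable_on {2<..} (\<lambda>N. Lp_norm 4 (high_pass riemann_fun N) ^ 4) (\<lambda>N. real N powr (-3) * ln (real N))"
    and "comparable_on {2<..} (\<lambda>N. Lp_norm 2 (high_pass riemann_fun N) ^ 2) (\<lambda>N. real N powr (-3/2))"
    by (intro comparable_onI[of "3 / 2560 * (1 / 1764) ^ 4" _ _ _ "37 * 4 ^ 4"]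
        comparable_onI[of "(1 / 1764)\<^sup>2 / 8" _ _ _ "4\<^sup>2"]; simp)+
qed

lemma structure_fun_riemann:
  "structure_fun riemann_fun (numeral j) l
     = circle_integral (\<lambda>x. norm (sq_trig_series (\<lambda>m. 2 * sin (pi * (real m)\<^sup>2 * l) / (real m)\<^sup>2) (l / 2) x) ^ numeral j)"
  unfolding structure_fun_def riemann_fun_diff by (simp add: norm_mult)

text \<open>The range of \<open>l\<close> ensures \<open>y \<ge> 28800\<close>, so
  \<open>ln (1 / l) = ln 28800 + ln y\<close> lies between \<open>ln y\<close> and
  \<open>2 * ln y\<close>. This costs the factor 1/2 in \<open>c4\<close>; the powers of 28800 come
  from rewriting \<open>y\<close> in terms of \<open>l\<close>.\<close>

lemma riemann_structure_comparable:
  defines "l0 \<equiv> 1 / 28800\<^sup>2"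
  shows "comparable_on {0<..<l0} (\<lambda>l. structure_fun riemann_fun 4 l) (\<lambda>l. l ^ 3 * ln (1 / l))"
    and "comparable_on {0<..<l0} (\<lambda>l. structure_fun riemann_fun 2 l) (\<lambda>l. l powr (3/2))"
proof -
  define c4 :: real where "c4 = 3 / 2560 * (1 / 28800) ^ 4 * 28800 ^ 3 / 2"
  define C4 :: real where "C4 = 37 * 8 ^ 4 * 28800 ^ 3"
  define c2 :: real where "c2 = (1 / 28800)\<^sup>2 / 8 * 28800 powr (3/2)"
  define C2 :: real where "C2 = 8\<^sup>2 * 28800 powr (3/2)"
  have bounds: "c4 * (l ^ 3 * ln (1 / l)) \<le> structure_fun riemann_fun 4 l \<and>
      structure_fun riemann_fun 4 l \<le> C4 * (l ^ 3 * ln (1 / l)) \<and>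
      c2 * l powr (3/2) \<le> structure_fun riemann_fun 2 l \<and>
      structure_fun riemann_fun 2 l \<le> C2 * l powr (3/2)" if l: "0 < l" "l < l0" for l
  proof -
    define y where "y = 1 / (28800 * l)"
    have l': "28800 * l \<le> 1 / 28800" using l by (simp add: l0_def field_simps)
    then have "28800 * l \<le> 1" by simp
    then obtain M where M: "y \<le> (real M)\<^sup>2" "(real M)\<^sup>2 \<le> 4 * y"
      and w: "sq_weights (\<lambda>m. 2 * sin (pi * (real m)\<^sup>2 * l) / (real m)\<^sup>2) M (1 / 28800) 8"
      using structure_riemann_weights[of l] l unfolding y_def by blast
    interpret sq_weights "\<lambda>m. 2 * sin (pi * (real m)\<^sup>2 * l) / (real m)\<^sup>2" M "1 / 28800" 8 by (fact w)
    have I: "structure_fun riemann_fun (numeral j) l = moment (l / 2) (numeral j)" for j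
      unfolding moment_def by (rule structure_fun_riemann)
    have y28800: "28800 \<le> y" using l l' by (simp add: y_def field_simps)
    then have y3: "3 \<le> y" by simp
    have yp: "y powr (-3) = 28800 ^ 3 * l ^ 3" "y powr (-3/2) = 28800 powr (3/2) * l powr (3/2)"
    proof -
      have *: "y powr (- a) = 28800 powr a * l powr a" for a
        using l by (simp add: y_def powr_minus powr_divide powr_mult inverse_eq_divide)
      from *[of 3] show "y powr (-3) = 28800 ^ 3 * l ^ 3" using l by simp
      from *[of "3/2"] show "y powr (-3/2) = 28800 powr (3/2) * l powr (3/2)" by simp
    qed
    have "1 / l = 28800 * y" using l by (simp add: y_def)
    then have "ln (1 / l) = ln (28800 * y)" by (simp only:)
    then have "ln (1 / l) = ln 28800 + ln y" using y3 by (subst (asm) ln_mult) auto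
    moreover have "ln 28800 \<le> ln y" "0 \<le> ln (28800 :: real)" using y28800 by (auto intro!: ln_mono)
    ultimately have lny: "ln (1 / l) / 2 \<le> ln y" "ln y \<le> ln (1 / l)" by linarith+
    have "c4 * (l ^ 3 * ln (1 / l)) = 3 / 2560 * (1 / 28800) ^ 4 * (y powr (-3) * (ln (1 / l) / 2))"
      unfolding yp c4_def by simp
    also have "\<dots> \<le> 3 / 2560 * (1 / 28800) ^ 4 * (y powr (-3) * ln y)"
      by (intro mult_left_mono lny) auto
    also have "\<dots> \<le> moment (l / 2) 4" by (rule moment4_comparable[OF y3 M])
    finally have 1: "c4 * (l ^ 3 * ln (1 / l)) \<le> moment (l / 2) 4" .
    have "moment (l / 2) 4 \<le> 37 * 8 ^ 4 * (y powr (-3) * ln y)" by (rule moment4_comparable[OF y3 M])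
    also have "\<dots> \<le> 37 * 8 ^ 4 * (y powr (-3) * ln (1 / l))"
      by (intro mult_left_mono lny) auto
    also have "\<dots> = C4 * (l ^ 3 * ln (1 / l))" unfolding yp C4_def by (simp only: mult.assoc)
    finally have 2: "moment (l / 2) 4 \<le> C4 * (l ^ 3 * ln (1 / l))" .
    have 3: "c2 * l powr (3/2) \<le> moment (l / 2) 2" "moment (l / 2) 2 \<le> C2 * l powr (3/2)"
      using moment2_comparable[OF y3 M, of "l / 2"] unfolding yp c2_def C2_def by (simp_all only: mult.assoc)
    show ?thesis unfolding I using 1 2 3 by blast
  qed
  have pos: "0 < c4" "0 < c2" by (simp_all add: c4_def c2_def)
  have "l0 < 1" by (simp add: l0_def)
  show "comparable_on {0<..<l0} (\<lambda>l. structure_fun riemann_fun 4 l) (\<lambda>l. l ^ 3 * ln (1 / l))"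
    using bounds \<open>l0 < 1\<close> by (intro comparable_onI[OF pos(1), where C = C4]) (auto intro!: mult_pos_pos)
  show "comparable_on {0<..<l0} (\<lambda>l. structure_fun riemann_fun 2 l) (\<lambda>l. l powr (3/2))"
    using bounds by (intro comparable_onI[OF pos(2), where C = C2]) auto
qed

theorem theorem3:
  "(\<exists>(N0::nat) (l0::real). 0 < l0 \<and> l0 < 1 \<and>
      comparable_on {N0<..} (\<lambda>N. Lp_norm 4 (high_pass riemann_fun N) ^ 4)
                            (\<lambda>N. real N powr (-3) * ln (real N)) \<and>
      comparable_on {N0<..} (\<lambda>N. Lp_norm 2 (high_pass riemann_fun N) ^ 2)
                            (\<lambda>N. real N powr (-3/2)) \<and>
      comparable_on {0<..<l0} (\<lambda>l. structure_fun riemann_fun 4 l) (\<lambda>l. l ^ 3 * ln (1 / l)) \<and>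
      comparable_on {0<..<l0} (\<lambda>l. structure_fun riemann_fun 2 l) (\<lambda>l. l powr (3/2)) \<and>
      comparable_on {N0<..} (\<lambda>N. filter_flatness riemann_fun N) (\<lambda>N. ln (real N)) \<and>
      comparable_on {0<..<l0} (\<lambda>l. structure_flatness riemann_fun l) (\<lambda>l. ln (1 / l))) \<and>
   filterlim (filter_flatness riemann_fun) at_top sequentially \<and>
   filterlim (structure_flatness riemann_fun) at_top (at_right 0)"
proof -
  define l0 :: real where "l0 = 1 / 28800\<^sup>2"
  have l0: "0 < l0" "l0 < 1" by (simp_all add: l0_def)
  note hp = riemann_high_pass_comparable
  note sf = riemann_structure_comparable[folded l0_def]
  have F: "comparable_on {2<..} (filter_flatness riemann_fun) (\<lambda>N. ln (real N))"
  proof -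
    \<comment> \<open>Dividing by the squared second moment cancels the powers of \<open>N\<close>,
      since -3 is twice -3/2, and leaves the logarithm.\<close>
    have "comparable_on {2<..} (\<lambda>N. Lp_norm 4 (high_pass riemann_fun N) ^ 4 / (Lp_norm 2 (high_pass riemann_fun N) ^ 2)\<^sup>2)
        (\<lambda>N. ln (real N))"
      using hp by (rule comparable_on_flatness) (simp add: powr_powr flip: powr_numeral)
    then show ?thesis by (simp add: filter_flatness_def[abs_def] flip: power_mult)
  qed
  have G: "comparable_on {0<..<l0} (structure_flatness riemann_fun) (\<lambda>l. ln (1 / l))"
    unfolding structure_flatness_def[abs_def]
    using sf by (rule comparable_on_flatness) (simp add: powr_powr flip: powr_numeral)
  have "filterlim (filter_flatness riemann_fun) at_top sequentially"
    using F
  proof (rule comparable_on_at_top)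
    show "\<forall>\<^sub>F N in sequentially. N \<in> {2<..}"
      using eventually_gt_at_top[of 2] by simp
    show "filterlim (\<lambda>N. ln (real N)) at_top sequentially"
      by (rule filterlim_compose[OF ln_at_top filterlim_real_sequentially])
  qed
  moreover have "filterlim (structure_flatness riemann_fun) at_top (at_right 0)"
    using G
  proof (rule comparable_on_at_top)
    show "\<forall>\<^sub>F l in at_right 0. l \<in> {0<..<l0}"
      using l0 by (intro eventually_at_right_real) auto
    have "filterlim (\<lambda>l::real. inverse l) at_top (at_right 0)" by (rule filterlim_inverse_at_top_right)
    then show "filterlim (\<lambda>l. ln (1 / l)) at_top (at_right (0::real))"
      unfolding inverse_eq_divide by (rule filterlim_compose[OF ln_at_top])
  qed
  ultimately show ?thesis using l0 hp sf F G by blast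
qed

end
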